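(* Let $\mathtt z>0$ satisfy $\mathtt z\le\mathfrak g^2/4$, and suppose that conditions (I), (ED0), (L0), (C) below hold. Then with probability at least $1-(2e^{-\mathtt z}+8.4e^{-\mathfrak g^2/4})$ one has $\widetilde\theta\in\Theta_n(\mathtt z)$ and $$\|D_n(\widetilde\theta-\theta^* )-\xi\|\le\diamondsuit(n,\mathtt z):=\mathtt r_0(\mathtt z)\,\delta_n(\mathtt r_0(\mathtt z)).$$
   Context: Setting. Fix integers $d,p\ge1$, $n\ge1$, a bandwidth $h>0$ and a point $x_0\in\mathbb R^d$. Let $X_1,\dots,X_n$ be i.i.d. random vectors in $\mathbb R^d$ with Lebesgue density $f$. Let $K:\mathbb R^d\to[0,\infty)$ be a bounded measurable kernel vanishing outside $[-1,1]^d$, and let $\psi_0,\dots,\psi_{p-1}:[-1,1]^d\to\mathbb R$ be bounded measurable functions with $\psi_0\equiv1$, linearly independent on $\{K>0\}$; write $\Psi(t)=(\psi_0(t),\dots,\psi_{p-1}(t))^\top$ (extended by $0$ outside $[-1,1]^d$). Put $T_i=(X_i-x_0)/h$ and define the local log-likelihood $$L(\theta)=\sum_{i=1}^n K(T_i)\Psi(T_i)^\top\theta-nh^d\int_{[-1,1]^d}K(t)\exp(\Psi(t)^\top\theta)\,dt,\qquad \theta\in\mathbb R^p.$$ Let $\widetilde\theta=\arg\max_\theta L(\theta)$ and $\theta^*=\arg\max_\theta \mathbf E L(\theta)$ (both assumed to exist). Define $D_n^2(\theta)=-\nabla^2\mathbf E L(\theta)=nh^d\int K(t)\Psi(t)\Psi(t)^\top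 e^{\Psi(t)^\top\theta}dt$, $D_n^2=D_n^2(\theta^* )$ with $D_n$ its symmetric positive definite square root, score vector $\xi=D_n^{-1}\nabla L(\theta^* )$, and $V_n^2=\mathrm{Var}(\nabla L(\theta^* ))$ (assumed positive definite). Set $\zeta(p,\mathtt z)=\mathfrak a\nu_0(\sqrt p+\sqrt{2\mathtt z})$, $\mathtt r_0(\mathtt z)=4\mathfrak a\nu_0(\sqrt p+\sqrt{2\mathtt z})$ and $\Theta_n(\mathtt z)=\{\theta:\|D_n(\theta-\theta^* )\|\le\mathtt r_0(\mathtt z)\}$. $\|\cdot\|$ is the Euclidean norm on vectors and operator norm on matrices; $\succeq$ is the Loewner order. Conditions. (I): $\mathfrak a^2D_n^2\succeq V_n^2$ for a constant $\mathfrak a>0$. (ED0): there are $\mathfrak g,\nu_0>0$ such that with $\boldsymbol\zeta=V_n^{-1}\nabla L(\theta^* )-\mathbf E V_n^{-1}\nabla L(\theta^* )$, for all nonzero $\gamma\in\mathbb R^p$ and all $|\lambda|\le\mathfrak g$, $\log\mathbf E\exp(\lambda\gamma^\top\boldsymbol\zeta/\|\gamma\|)\le\nu_0^2\lambda^2/2$. (L0): there is $\delta_n(\mathtt r_0(\mathtt z))\ge0$ such that for all $\theta\in\Theta_n(\mathtt z)$, $\|I_p-D_n^{-1}D_n^2(\theta)D_n^{-1}\|\le\delta_n(\mathtt r_0(\mathtt z))$. (C): $\mathtt r_0(\mathtt z)\,(1-\delta_n(\mathtt r_0(\mathtt z)))\ge2\zeta(p,\mathtt z)$. *)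

theory Defs
  imports "HOL-Probability.Probability"
begin

definition unit_cube :: "(real^'d) set" where
  "unit_cube = cbox (- 1) 1"

definition rescale :: "real \<Rightarrow> real^'d \<Rightarrow> real^'d \<Rightarrow> real^'d" where
  "rescale h x0 x = (1 / h) *\<^sub>R (x - x0)"

definition loglik ::
  "(real^'d \<Rightarrow> real) \<Rightarrow> (real^'d \<Rightarrow> real^'p) \<Rightarrow> ('w \<Rightarrow> nat \<Rightarrow> real^'d) \<Rightarrow> nat \<Rightarrow> real
     \<Rightarrow> real^'d \<Rightarrow> real^'p \<Rightarrow> 'w \<Rightarrow> real" where
  "loglik K Psi X n h x0 \<theta> \<omega> =
     (\<Sum>i<n. K (rescale h x0 (X \<omega> i)) * (Psi (rescale h x0 (X \<omega> i)) \<bullet> \<theta>))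
     - real n * h ^ CARD('d) * (\<integral>t\<in>unit_cube. K t * exp (Psi t \<bullet> \<theta>) \<partial>lborel)"

definition grad_at :: "(real^'p \<Rightarrow> real) \<Rightarrow> real^'p \<Rightarrow> real^'p" where
  "grad_at F x = (THE g. (F has_derivative (\<lambda>v. g \<bullet> v)) (at x))"

definition Dn2 ::
  "(real^'d \<Rightarrow> real) \<Rightarrow> (real^'d \<Rightarrow> real^'p) \<Rightarrow> nat \<Rightarrow> real \<Rightarrow> real^'p \<Rightarrow> real^'p^'p" where
  "Dn2 K Psi n h \<theta> = (\<chi> j k. real n * h ^ CARD('d) *
      (\<integral>t\<in>unit_cube. K t * (Psi t $ j) * (Psi t $ k) * exp (Psi t \<bullet> \<theta>) \<partial>lborel))"

definition covmat :: "'w measure \<Rightarrow> ('w \<Rightarrow> real^'p) \<Rightarrow> real^'p^'p" where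
  "covmat M G = (\<chi> j k. (\<integral>\<omega>. (G \<omega> $ j - (\<integral>\<omega>'. G \<omega>' $ j \<partial>M)) *
                               (G \<omega> $ k - (\<integral>\<omega>'. G \<omega>' $ k \<partial>M)) \<partial>M))"

definition loewner_le :: "real^'p^'p \<Rightarrow> real^'p^'p \<Rightarrow> bool" where
  "loewner_le A B \<longleftrightarrow> (\<forall>x. 0 \<le> x \<bullet> ((B - A) *v x))"

definition sym_mat :: "real^'p^'p \<Rightarrow> bool" where
  "sym_mat A \<longleftrightarrow> transpose A = A"

definition pos_def :: "real^'p^'p \<Rightarrow> bool" where
  "pos_def A \<longleftrightarrow> (\<forall>x. x \<noteq> 0 \<longrightarrow> 0 < x \<bullet> (A *v x))"

definition opnorm :: "real^'p^'q \<Rightarrow> real" where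
  "opnorm A = onorm (\<lambda>x. A *v x)"

end

theory Submission
  imports Defs
begin

text \<open>
  Since \<open>Var(\<zeta>) = I\<close>, condition (ED0) forces \<open>\<nu>0 \<ge> 1\<close>. It bounds the moments of order \<open>2k\<close> of
  every one-dimensional projection of \<open>\<zeta>\<close>; by homogeneity these bounds hold for all directions, so they can
  be averaged over a standard Gaussian direction, which turns them into a bound on \<open>E \<parallel>\<zeta>\<parallel>\<^sup>2\<^sup>k\<close>. Markov's inequality
  with \<open>k = \<lfloor>2z\<rfloor>\<close> gives \<open>P(\<parallel>\<zeta>\<parallel> \<ge> 2\<nu>0(\<surd>p + \<surd>(2z))) \<le> 2exp(-z)\<close>: the factor 2 is the one that
  condition (C) leaves free, and it makes a lower bound on \<open>g\<close> in terms of \<open>p\<close> unnecessary.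

  Condition (I) yields \<open>\<parallel>\<xi>\<parallel> \<le> a\<parallel>\<zeta>\<parallel>\<close>, so with this probability \<open>\<parallel>\<xi>\<parallel> < r0(1 - \<delta>)\<close>. Both
  maximisers are critical points, so \<open>\<xi>\<close> is \<open>D\<inverse>\<close> applied to the increment of the gradient of the
  convex term of the likelihood. If the maximiser of \<open>L\<close> lay outside the ball, monotonicity of that
  gradient on the segment, compared with (L0) inside the ball, would give \<open>\<parallel>\<xi>\<parallel> \<ge> r0(1 - \<delta>)\<close>; inside
  the ball the mean value theorem and (L0) give the expansion.
\<close>

section \<open>Gaussian averaging of directional moments\<close>

definition std_gauss :: "real measure" where
  "std_gauss = density lborel (\<lambda>x. ennreal (std_normal_density x))"

lemma prob_space_std_gauss: "prob_space std_gauss"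
  unfolding std_gauss_def by (rule prob_space_normal_density) simp

lemma sets_std_gauss [measurable_cong, simp]: "sets std_gauss = sets borel"
  by (simp add: std_gauss_def)

lemma space_std_gauss [simp]: "space std_gauss = UNIV"
  by (simp add: std_gauss_def)

interpretation gauss: product_sigma_finite "\<lambda>_. std_gauss"
  by (simp add: product_sigma_finite_def prob_space_std_gauss prob_space_imp_sigma_finite)

text \<open>The usual value \<open>fact (2 * k) / (2 ^ k * fact k)\<close> is rewritten through the
  Pochhammer symbol at 1/2, the form in which binomial convolutions of moments can be summed in
  closed form.\<close>

lemma nn_integral_std_gauss_even_power:
  "(\<integral>\<^sup>+ x. ennreal (x ^ (2 * k)) \<partial>std_gauss) = ennreal (2 ^ k * pochhammer (1/2) k)"
proof -
  have "fact (2 * k) / (2 ^ k * fact k) = (2 ^ k * pochhammer (1/2) k :: real)"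
    unfolding fact_double by (simp add: mult_2 power_add)
  then have "has_bochner_integral lborel (\<lambda>x. std_normal_density x * x ^ (2 * k)) (2 ^ k * pochhammer (1/2) k)"
    using std_normal_moment_even[of k] by simp
  then have "(\<integral>\<^sup>+ x. ennreal (std_normal_density x * x ^ (2 * k)) \<partial>lborel) = ennreal (2 ^ k * pochhammer (1/2) k)"
    by (subst nn_integral_eq_integral)
       (auto simp: has_bochner_integral_iff power_mult intro!: mult_nonneg_nonneg)
  then show ?thesis
    by (simp add: std_gauss_def nn_integral_density ennreal_mult power_mult)
qed

text \<open>These are the moments of a chi-square variable with \<open>card I\<close> degrees of
  freedom. One coordinate is split off by Fubini, the power is expanded binomially, and the product
  of the two families of moments is summed by the Vandermonde identity for Pochhammer
  symbols.\<close>

lemma nn_integral_gauss_sum_squares_power: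
  assumes "finite I"
  shows "(\<integral>\<^sup>+ x. ennreal ((\<Sum>i\<in>I. (x i)\<^sup>2) ^ k) \<partial>PiM I (\<lambda>_. std_gauss)) =
    ennreal (2 ^ k * pochhammer (real (card I) / 2) k)"
  using assms
proof (induction I arbitrary: k rule: finite_induct)
  case empty
  interpret E: prob_space "PiM {} (\<lambda>_::'a. std_gauss)"
    by (rule prob_space_PiM) (rule prob_space_std_gauss)
  show ?case
    \<comment> \<open>The empty sum raised to the power k is 1 for k = 0 and 0 otherwise, exactly as
      \<open>pochhammer 0 k\<close>.\<close>
    by (cases k) (simp_all add: pochhammer_0_left E.emeasure_space_1)
next
  case (insert j I)
  let ?P = "PiM I (\<lambda>_. std_gauss)"
  have poch: "0 \<le> pochhammer (real (card I) / 2) l" for l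
    by (simp add: pochhammer_prod prod_nonneg)
  have sq: "(\<Sum>i\<in>I. ((x(j := y)) i)\<^sup>2) = (\<Sum>i\<in>I. (x i)\<^sup>2)" for x :: "'a \<Rightarrow> real" and y
    using insert by (intro sum.cong) auto
  have binom: "((\<Sum>i\<in>insert j I. ((x(j := y)) i)\<^sup>2) ^ k) =
      (\<Sum>l\<le>k. real (k choose l) * y ^ (2 * l) * (\<Sum>i\<in>I. (x i)\<^sup>2) ^ (k - l))" for x :: "'a \<Rightarrow> real" and y
    using insert by (simp add: sq binomial_ring power_mult del: fun_upd_apply) simp
  have "(\<integral>\<^sup>+ x. ennreal ((\<Sum>i\<in>insert j I. (x i)\<^sup>2) ^ k) \<partial>PiM (insert j I) (\<lambda>_. std_gauss)) =
     (\<integral>\<^sup>+ x. \<integral>\<^sup>+ y. ennreal ((\<Sum>i\<in>insert j I. ((x(j := y)) i)\<^sup>2) ^ k) \<partial>std_gauss \<partial>?P)"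
    using insert by (intro gauss.product_nn_integral_insert) auto
  also have "\<dots> = (\<integral>\<^sup>+ x. \<integral>\<^sup>+ y. (\<Sum>l\<le>k. ennreal (real (k choose l) * (\<Sum>i\<in>I. (x i)\<^sup>2) ^ (k - l)) * ennreal (y ^ (2 * l))) \<partial>std_gauss \<partial>?P)"
    unfolding binom
    by (intro nn_integral_cong)
       (auto simp: power_mult sum_nonneg mult_ac simp flip: ennreal_mult intro!: sum.cong)
  also have "\<dots> = (\<integral>\<^sup>+ x. (\<Sum>l\<le>k. ennreal (real (k choose l) * (2 ^ l * pochhammer (1/2) l)) * ennreal ((\<Sum>i\<in>I. (x i)\<^sup>2) ^ (k - l))) \<partial>?P)"
    by (intro nn_integral_cong)
       (simp add: nn_integral_sum nn_integral_cmult nn_integral_std_gauss_even_power, simp add: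
          ennreal_mult sum_nonneg pochhammer_nonneg mult_ac)
  also have "\<dots> = (\<Sum>l\<le>k. ennreal (real (k choose l) * (2 ^ l * pochhammer (1/2) l)) * ennreal (2 ^ (k - l) * pochhammer (real (card I) / 2) (k - l)))"
    by (subst nn_integral_sum) (auto simp: nn_integral_cmult insert.IH)
  also have "\<dots> = ennreal (\<Sum>l\<le>k. (real (k choose l) * (2 ^ l * pochhammer (1/2) l)) * (2 ^ (k - l) * pochhammer (real (card I) / 2) (k - l)))"
    by (subst sum_ennreal[symmetric])
       (auto simp: ennreal_mult pochhammer_nonneg poch intro!: sum.cong mult_nonneg_nonneg)
  also have "(\<Sum>l\<le>k. (real (k choose l) * (2 ^ l * pochhammer (1/2) l)) * (2 ^ (k - l) * pochhammer (real (card I) / 2) (k - l))) = 2 ^ k * pochhammer (1/2 + real (card I) / 2) k"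
    unfolding pochhammer_binomial_sum sum_distrib_left
    by (intro sum.cong refl) (simp add: mult_ac flip: power_add)
  also have "1/2 + real (card I) / 2 = real (card (insert j I)) / 2"
    using insert by (simp add: field_simps)
  finally show ?case .
qed

text \<open>A linear combination of independent standard normals is centred normal with variance the
  sum of the squared coefficients, so its even moments are known. They depend on \<open>y\<close>
  only through its Euclidean norm, which is what makes averaging over directions useful.\<close>

lemma nn_integral_gauss_linear_even_power:
  fixes y :: "'i::finite \<Rightarrow> real"
  shows "(\<integral>\<^sup>+ x. ennreal ((\<Sum>i\<in>UNIV. y i * x i) ^ (2 * k)) \<partial>PiM UNIV (\<lambda>_. std_gauss)) =
    ennreal (fact (2 * k) / (2 ^ k * fact k) * (\<Sum>i\<in>UNIV. (y i)\<^sup>2) ^ k)"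
proof -
  let ?P = "PiM (UNIV::'i set) (\<lambda>_. std_gauss)"
  interpret P: prob_space ?P by (rule prob_space_PiM) (rule prob_space_std_gauss)
  \<comment> \<open>Vanishing coefficients are dropped because a degenerate summand has no normal
    density; if none remains, the linear form is identically 0.\<close>
  define J where "J = {i. y i \<noteq> 0}"
  have sum_J: "(\<Sum>i\<in>UNIV. y i * x i) = (\<Sum>i\<in>J. y i * x i)" for x
    unfolding J_def by (intro sum.mono_neutral_right) auto
  have sq_J: "(\<Sum>i\<in>UNIV. (y i)\<^sup>2) = (\<Sum>i\<in>J. (\<bar>y i\<bar> * 1)\<^sup>2)"
    unfolding J_def by (simp, intro sum.mono_neutral_right) auto
  show ?thesis
  proof (cases "J = {}")
    case True
    then show ?thesis unfolding sum_J sq_J by (cases k) (auto simp: P.emeasure_space_1)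
  next
    case False
    have comp: "distr ?P std_gauss (\<lambda>x. x i) = std_gauss" for i
      by (rule distr_PiM_component) (auto simp: prob_space_std_gauss)
    have "P.indep_vars (\<lambda>_. std_gauss) (\<lambda>i x. x i) UNIV"
      by (subst P.indep_vars_iff_distr_eq_PiM') (auto simp: comp restrict_UNIV)
    then have "P.indep_vars (\<lambda>_. std_gauss) (\<lambda>i x. x i) J"
      by (rule P.indep_vars_subset) auto
    then have ind: "P.indep_vars (\<lambda>_. borel) (\<lambda>i x. y i * x i) J"
      by (rule P.indep_vars_compose2) auto
    have "distributed ?P lborel (\<lambda>x. x i) std_normal_density" for i
      unfolding distributed_def
      using comp[of i] by (auto simp: std_gauss_def cong: distr_cong)
    from P.normal_density_affine[OF this, of _ 0]
    have "distributed ?P lborel (\<lambda>x. y i * x i) (normal_density 0 (\<bar>y i\<bar> * 1))" if "i \<in> J" for i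
      using that by (auto simp: J_def)
    then have dist: "distributed ?P lborel (\<lambda>x. \<Sum>i\<in>J. y i * x i)
        (normal_density 0 (sqrt (\<Sum>i\<in>J. (\<bar>y i\<bar> * 1)\<^sup>2)))"
      using P.sum_indep_normal[OF _ False ind, of "\<lambda>i. \<bar>y i\<bar> * 1" "\<lambda>_. 0"]
      by (auto simp: J_def)
    let ?s = "sqrt (\<Sum>i\<in>J. (\<bar>y i\<bar> * 1)\<^sup>2)"
    have pos: "?s > 0"
      using False by (auto simp: J_def intro!: sum_pos)
    have s2: "?s\<^sup>2 = (\<Sum>i\<in>UNIV. (y i)\<^sup>2)"
      unfolding sq_J by (simp add: sum_nonneg)
    have "(\<integral>\<^sup>+ x. ennreal ((\<Sum>i\<in>J. y i * x i) ^ (2 * k)) \<partial>?P) =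
        (\<integral>\<^sup>+ x. ennreal (normal_density 0 ?s x) * ennreal (x ^ (2 * k)) \<partial>lborel)"
      by (rule distributed_nn_integral[OF dist, symmetric]) auto
    also have "\<dots> = (\<integral>\<^sup>+ x. ennreal (normal_density 0 ?s x * (x - 0) ^ (2 * k)) \<partial>lborel)"
      by (simp add: ennreal_mult power_mult)
    also have "\<dots> = ennreal (fact (2 * k) / ((2 / ?s\<^sup>2)^k * fact k))"
      using normal_moment_even[OF pos, of 0 k]
      by (subst nn_integral_eq_integral) (auto simp: has_bochner_integral_iff power_mult intro!: mult_nonneg_nonneg)
    also have "fact (2 * k) / ((2 / ?s\<^sup>2)^k * fact k) = fact (2 * k) / (2 ^ k * fact k) * (\<Sum>i\<in>UNIV. (y i)\<^sup>2) ^ k"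
      unfolding s2 by (simp add: power_divide)
    finally show ?thesis unfolding sum_J .
  qed
qed

text \<open>For a standard Gaussian x independent of Y, the moment of x . Y of order 2k is computed
  in two orders. With Y fixed it is a Gaussian moment proportional to the power of the norm of Y;
  with x fixed, \<open>dir\<close> bounds it by C times the power of the norm of x, whose mean is a
  chi-square moment.\<close>

lemma (in prob_space) expectation_norm_power_le:
  fixes Y :: "'a \<Rightarrow> real^'p"
  assumes Y [measurable]: "Y \<in> borel_measurable M" and bdd: "\<And>\<omega>. \<omega> \<in> space M \<Longrightarrow> norm (Y \<omega>) \<le> B"
    and C: "C \<ge> 0"
    and dir: "\<And>u. expectation (\<lambda>\<omega>. (u \<bullet> Y \<omega>) ^ (2 * k)) \<le> C * norm u ^ (2 * k)"
  shows "fact (2 * k) / (2 ^ k * fact k) * expectation (\<lambda>\<omega>. norm (Y \<omega>) ^ (2 * k))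
    \<le> C * (2 ^ k * pochhammer (real CARD('p) / 2) k)"
proof -
  let ?P = "PiM (UNIV::'p set) (\<lambda>_. std_gauss)"
  let ?c = "fact (2 * k) / (2 ^ k * fact k) :: real"
  interpret P: prob_space ?P by (rule prob_space_PiM) (rule prob_space_std_gauss)
  interpret pair_sigma_finite M ?P ..
  have norm_eq: "norm y ^ (2 * k) = (\<Sum>i\<in>UNIV. (y $ i)\<^sup>2) ^ k" for y :: "real^'p"
    by (simp add: power_mult norm_vec_def L2_set_def sum_nonneg)
  have int: "integrable M (\<lambda>\<omega>. norm (Y \<omega>) ^ (2 * k))"
    using bdd by (intro integrable_const_bound[where B = "B ^ (2 * k)"]) (auto intro!: power_mono)
  have int_dir: "integrable M (\<lambda>\<omega>. (u \<bullet> Y \<omega>) ^ (2 * k))" for u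
  proof (rule integrable_const_bound[where B = "(norm u * B) ^ (2 * k)"])
    show "AE \<omega> in M. norm ((u \<bullet> Y \<omega>) ^ (2 * k)) \<le> (norm u * B) ^ (2 * k)"
    proof (rule AE_I2)
      fix \<omega> assume "\<omega> \<in> space M"
      then have "\<bar>u \<bullet> Y \<omega>\<bar> \<le> norm u * B"
        using bdd[of \<omega>] by (meson Cauchy_Schwarz_ineq2 mult_left_mono norm_ge_zero order_trans)
      then show "norm ((u \<bullet> Y \<omega>) ^ (2 * k)) \<le> (norm u * B) ^ (2 * k)"
        by (auto simp: power_abs intro!: power_mono)
    qed
  qed simp
  have [measurable]: "(\<lambda>\<omega>. Y \<omega> $ i) \<in> borel_measurable M" for i
    using measurable_compose[OF Y borel_measurable_nth] by (simp add: o_def)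
  have "ennreal (?c * expectation (\<lambda>\<omega>. norm (Y \<omega>) ^ (2 * k))) = (\<integral>\<^sup>+ \<omega>. ennreal (?c * norm (Y \<omega>) ^ (2 * k)) \<partial>M)"
    using int by (subst nn_integral_eq_integral) auto
  also have "\<dots> = (\<integral>\<^sup>+ \<omega>. \<integral>\<^sup>+ x. ennreal ((\<Sum>i\<in>UNIV. Y \<omega> $ i * x i) ^ (2 * k)) \<partial>?P \<partial>M)"
    by (simp only: norm_eq nn_integral_gauss_linear_even_power)
  \<comment> \<open>Exchanging the two averages turns the norm of Y into its one-dimensional
    projections.\<close>
  also have "\<dots> = (\<integral>\<^sup>+ x. \<integral>\<^sup>+ \<omega>. ennreal ((\<Sum>i\<in>UNIV. Y \<omega> $ i * x i) ^ (2 * k)) \<partial>M \<partial>?P)"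
    by (rule Fubini'[symmetric]) measurable
  also have "\<dots> \<le> (\<integral>\<^sup>+ x. ennreal C * ennreal ((\<Sum>i\<in>UNIV. (x i)\<^sup>2) ^ k) \<partial>?P)"
  proof (rule nn_integral_mono)
    fix x :: "'p \<Rightarrow> real"
    let ?u = "\<chi> i. x i"
    have "(\<integral>\<^sup>+ \<omega>. ennreal ((\<Sum>i\<in>UNIV. Y \<omega> $ i * x i) ^ (2 * k)) \<partial>M) = ennreal (expectation (\<lambda>\<omega>. (?u \<bullet> Y \<omega>) ^ (2 * k)))"
      using int_dir[of ?u]
      by (subst nn_integral_eq_integral[symmetric]) (simp_all add: inner_vec_def power_mult mult.commute[of "x _"])
    also have "\<dots> \<le> ennreal (C * norm ?u ^ (2 * k))"
      using dir by (rule ennreal_leI)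
    also have "\<dots> = ennreal C * ennreal ((\<Sum>i\<in>UNIV. (x i)\<^sup>2) ^ k)"
      using C unfolding norm_eq by (simp add: ennreal_mult sum_nonneg)
    finally show "(\<integral>\<^sup>+ \<omega>. ennreal ((\<Sum>i\<in>UNIV. Y \<omega> $ i * x i) ^ (2 * k)) \<partial>M) \<le> \<dots>" .
  qed
  also have "\<dots> = ennreal (C * (2 ^ k * pochhammer (real CARD('p) / 2) k))"
    using C by (simp add: nn_integral_cmult nn_integral_gauss_sum_squares_power ennreal_mult pochhammer_nonneg)
  finally show ?thesis
    using C by (subst (asm) ennreal_le_iff) (auto simp: pochhammer_nonneg)
qed

section \<open>Deviation bound\<close>

lemma cosh_sums_real: "(\<lambda>n. if even n then x ^ n / fact n else 0) sums cosh x" for x :: real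
  using cosh_converges[of x] by (simp add: divide_inverse mult.commute cong: if_cong)

text \<open>All terms of the cosh series are nonnegative, so a single one is at most the sum. This
  converts exponential moments into even power moments.\<close>

lemma even_power_le_cosh: "x ^ (2 * k) \<le> fact (2 * k) * cosh x" for x :: real
proof -
  have "(\<Sum>n\<in>{2 * k}. if even n then x ^ n / fact n else 0) \<le> cosh x"
    unfolding sums_unique[OF cosh_sums_real]
    by (rule sum_le_suminf[OF sums_summable[OF cosh_sums_real]]) (auto elim!: evenE simp: power_mult)
  then show ?thesis by (simp add: field_simps)
qed

lemma one_plus_half_square_le_cosh: "1 + x\<^sup>2 / 2 \<le> cosh x" for x :: real
proof -
  have "(\<Sum>n\<in>{0, 2}. if even n then x ^ n / fact n else 0) \<le> cosh x"
    unfolding sums_unique[OF cosh_sums_real]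
    by (rule sum_le_suminf[OF sums_summable[OF cosh_sums_real]]) (auto elim!: evenE simp: power_mult)
  then show ?thesis by (simp add: numeral_2_eq_2)
qed

text \<open>The left side is the product p (p + 2) ... (p + 2k - 2), whose factors have mean p + k -
  1. The induction step with q = p + k reduces to Bernoulli's inequality
  \<open>1 + k / q <= (1 + 1 / q) ^ k\<close>.\<close>

lemma double_pochhammer_half_le:
  assumes "p > 0"
  shows "2 ^ k * pochhammer (p / 2) k \<le> (p + real k) ^ k"
proof (induction k)
  case (Suc k)
  let ?q = "p + real k"
  have q: "?q > 0" using assms by simp
  have "2 ^ Suc k * pochhammer (p / 2) (Suc k) = (2 ^ k * pochhammer (p / 2) k) * (p + 2 * real k)"
    by (simp add: pochhammer_Suc algebra_simps)
  also have "\<dots> \<le> ?q ^ k * (p + 2 * real k)"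
    using Suc assms by (intro mult_right_mono) auto
  also have "\<dots> = ?q ^ k * (1 + real k * (1 / ?q)) * ?q"
    using q by (simp add: field_simps)
  also have "\<dots> \<le> ?q ^ k * (1 + 1 / ?q) ^ k * (?q + 1)"
    using q Bernoulli_inequality[of "1 / ?q" k] order_trans[OF _ divide_nonneg_pos[OF zero_le_one q], of "- 1"]
    by (intro mult_mono mult_left_mono) auto
  also have "\<dots> = (?q + 1) ^ Suc k"
    using q by (simp add: power_mult_distrib[symmetric] field_simps)
  finally show ?case by (simp add: add_ac)
qed simp

text \<open>The ratio of consecutive left sides is (e/4) (k/(k+1))^k, at most e/8 by Bernoulli, and
  this is below the ratio exp(-1/2) of the right sides. Both this comparison and the base case
  follow from e^2 <= 8. The exponent on the right fits k = floor(2z), for which z < (k +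
  1)/2.\<close>

lemma fact_exp_over_power_le:
  assumes "k \<ge> 1"
  shows "fact k * exp (real k) / (4 * real k) ^ k \<le> 2 * exp (- (real k + 1) / 2)"
  using assms
proof (induction k rule: dec_induct)
  case base
  have "exp 1 * exp 1 \<le> (272/100) * (272/100 :: real)"
    using e_less_272 by (intro mult_mono) auto
  then show ?case by (simp add: exp_minus field_simps)
next
  case (step k)
  let ?c = "\<lambda>k. fact k * exp (real k) / (4 * real k) ^ k"
  have k: "real k > 0" using step by simp
  have "2 * real k ^ k \<le> (1 + real k * (1 / real k)) * real k ^ k"
    using k by simp
  also have "\<dots> \<le> (1 + 1 / real k) ^ k * real k ^ k"
    using k Bernoulli_inequality[of "1 / real k" k] order_trans[OF _ divide_nonneg_pos[OF zero_le_one k], of "- 1"]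
    by (intro mult_right_mono) auto
  also have "\<dots> = (1 + real k) ^ k"
    using k by (simp add: power_mult_distrib[symmetric] field_simps)
  finally have two: "2 * real k ^ k \<le> (1 + real k) ^ k" .
  have "?c (Suc k) = (fact k * exp (real k) / 4 ^ k) * (exp 1 / 4) / (1 + real k) ^ k"
  proof -
    define m where "m = real (Suc k)"
    have e: "exp m = exp (real k) * exp 1" "1 + real k = m" "m \<noteq> 0" by (simp_all add: m_def flip: exp_add)
    then show ?thesis
      unfolding power_mult_distrib power_Suc fact_Suc e m_def[symmetric] by simp
  qed
  also have "\<dots> \<le> (fact k * exp (real k) / 4 ^ k) * (exp 1 / 4) / (2 * real k ^ k)"
    using k two by (intro divide_left_mono mult_nonneg_nonneg) auto
  also have "\<dots> = ?c k * (exp 1 / 8)"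
    by (simp add: power_mult_distrib field_simps)
  also have "\<dots> \<le> (2 * exp (- (real k + 1) / 2)) * exp (- 1 / 2)"
  proof (rule mult_mono)
    have "exp (3 / 2) \<le> exp (2 :: real)" by simp
    also have "exp 2 = exp 1 * exp (1 :: real)" by (simp flip: exp_add)
    also have "\<dots> \<le> (272/100) * (272/100 :: real)"
      using e_less_272 by (intro mult_mono) auto
    finally have "exp (3 / 2) \<le> (8::real)" by simp
    moreover have "exp (3 / 2) = exp 1 * exp (1 / 2 :: real)" by (simp flip: exp_add)
    ultimately show "exp 1 / 8 \<le> exp (- 1 / 2 :: real)"
      by (simp add: exp_minus field_simps)
  qed (use step in auto)
  also have "\<dots> = 2 * exp (- (real (Suc k) + 1) / 2)"
    by (simp add: exp_add[symmetric] field_simps)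
  finally show ?case .
qed

text \<open>A covering or exponential-moment argument for the norm would need \<open>g\<close> large
  compared with the dimension. Here the exponential moments are used only in one direction at a
  time, at a radius at most \<open>g\<close>; homogeneity of the power moments then removes the
  restriction on the direction vector before averaging.\<close>

lemma (in prob_space) prob_norm_ge_of_mgf_bound:
  fixes Y :: "'a \<Rightarrow> real^'p"
  assumes Y [measurable]: "Y \<in> borel_measurable M" and bdd: "\<And>\<omega>. \<omega> \<in> space M \<Longrightarrow> norm (Y \<omega>) \<le> B"
    and mgf: "\<And>v. norm v \<le> g \<Longrightarrow> expectation (\<lambda>\<omega>. exp (v \<bullet> Y \<omega>)) \<le> exp (\<nu>\<^sup>2 * (norm v)\<^sup>2 / 2)"
    and \<nu>: "\<nu> \<ge> 1" and g: "g > 0" and z: "z > 0" "z \<le> g\<^sup>2 / 4"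
  shows "prob {\<omega> \<in> space M. norm (Y \<omega>) \<ge> 2 * \<nu> * (sqrt (real CARD('p)) + sqrt (2 * z))} \<le> 2 * exp (- z)"
\<comment> \<open>For z < 1/2 the order k below would be 0, but then \<open>2 * exp (- z)\<close>
  already exceeds 1.\<close>
proof (cases "z < 1 / 2")
  case True
  then have "1 / 2 \<le> 1 + - z" by simp
  also have "\<dots> \<le> exp (- z)" by (rule exp_ge_add_one_self)
  finally show ?thesis by (intro order_trans[OF prob_le_1]) simp
next
  case False
  let ?p = "real CARD('p)"
  \<comment> \<open>This is the largest integer order with k <= 2z, which together with
    \<open>\<nu> \<ge> 1\<close> and z <= g^2/4 keeps the radius \<open>l\<close> below within
    \<open>g\<close>.\<close>
  define k where "k = nat \<lfloor>2 * z\<rfloor>"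
  have k1: "k \<ge> 1" and kz: "real k \<le> 2 * z" and zk: "2 * z < real k + 1"
    using False z unfolding k_def by linarith+
  \<comment> \<open>This radius minimises exp(\<nu>^2 l^2 / 2) / l^(2k); the exponent becomes
    exactly k.\<close>
  define l where "l = sqrt (2 * real k) / \<nu>"
  define C where "C = fact (2 * k) * exp (real k) / l ^ (2 * k)"
  have l: "l > 0" using k1 \<nu> by (simp add: l_def)
  have l2: "l\<^sup>2 = 2 * real k / \<nu>\<^sup>2" by (simp add: l_def power_divide)
  have "l \<le> sqrt (2 * real k)"
    using \<nu> mult_left_mono[OF \<nu>, of "sqrt (2 * real k)"] by (simp add: l_def divide_le_eq)
  also have "\<dots> \<le> g"
    using kz z g by (intro real_le_lsqrt) auto
  finally have lg: "l \<le> g" .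
  have C0: "C \<ge> 0" using l by (simp add: C_def)
  have int_exp: "integrable M (\<lambda>\<omega>. exp (v \<bullet> Y \<omega>))" for v
  proof (rule integrable_const_bound[where B = "exp (norm v * B)"])
    show "AE \<omega> in M. norm (exp (v \<bullet> Y \<omega>)) \<le> exp (norm v * B)"
    proof (rule AE_I2)
      fix \<omega> assume "\<omega> \<in> space M"
      then have "v \<bullet> Y \<omega> \<le> norm v * B"
        using bdd[of \<omega>] by (meson norm_cauchy_schwarz mult_left_mono norm_ge_zero order_trans)
      then show "norm (exp (v \<bullet> Y \<omega>)) \<le> exp (norm v * B)" by simp
    qed
  qed simp
  have dir: "expectation (\<lambda>\<omega>. (u \<bullet> Y \<omega>) ^ (2 * k)) \<le> C * norm u ^ (2 * k)" for u
  proof (cases "u = 0")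
    case True
    then show ?thesis using k1 by (simp add: zero_power)
  next
    case False
    \<comment> \<open>Both sides are homogeneous of degree 2k in \<open>u\<close>, so the direction
      may be rescaled to the radius at which \<open>mgf\<close> applies.\<close>
    define v where "v = (l / norm u) *\<^sub>R u"
    have nv: "norm v = l" using False l by (simp add: v_def)
    have cosh_eq: "cosh (v \<bullet> Y \<omega>) = (exp (v \<bullet> Y \<omega>) + exp ((- v) \<bullet> Y \<omega>)) / 2" for \<omega>
      by (simp add: cosh_field_def)
    have int_cosh: "integrable M (\<lambda>\<omega>. cosh (v \<bullet> Y \<omega>))"
      unfolding cosh_eq using int_exp by (intro integrable_divide Bochner_Integration.integrable_add)
    have "expectation (\<lambda>\<omega>. cosh (v \<bullet> Y \<omega>)) = (expectation (\<lambda>\<omega>. exp (v \<bullet> Y \<omega>)) + expectation (\<lambda>\<omega>. exp ((- v) \<bullet> Y \<omega>))) / 2"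
      unfolding cosh_eq using int_exp[of v] int_exp[of "- v"] by simp
    also have "\<dots> \<le> exp (\<nu>\<^sup>2 * l\<^sup>2 / 2)"
      using mgf[of v] mgf[of "- v"] lg nv by simp
    also have "\<dots> = exp (real k)"
      using \<nu> by (simp add: l2)
    finally have E: "expectation (\<lambda>\<omega>. cosh (v \<bullet> Y \<omega>)) \<le> exp (real k)" .
    have pw: "(u \<bullet> Y \<omega>) ^ (2 * k) = (norm u / l) ^ (2 * k) * (v \<bullet> Y \<omega>) ^ (2 * k)" for \<omega>
      unfolding power_mult_distrib[symmetric] using False l by (simp add: v_def)
    have "expectation (\<lambda>\<omega>. (u \<bullet> Y \<omega>) ^ (2 * k)) \<le> expectation (\<lambda>\<omega>. (norm u / l) ^ (2 * k) * (fact (2 * k) * cosh (v \<bullet> Y \<omega>)))"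
    proof (rule integral_mono')
      show "integrable M (\<lambda>\<omega>. (norm u / l) ^ (2 * k) * (fact (2 * k) * cosh (v \<bullet> Y \<omega>)))"
        using int_cosh by (intro integrable_mult_right)
      show "(u \<bullet> Y \<omega>) ^ (2 * k) \<le> (norm u / l) ^ (2 * k) * (fact (2 * k) * cosh (v \<bullet> Y \<omega>))" for \<omega>
        unfolding pw using l by (intro mult_left_mono even_power_le_cosh) auto
    qed (use l in \<open>auto intro!: mult_nonneg_nonneg\<close>)
    also have "\<dots> = (norm u / l) ^ (2 * k) * (fact (2 * k) * expectation (\<lambda>\<omega>. cosh (v \<bullet> Y \<omega>)))"
      by simp
    also have "\<dots> \<le> (norm u / l) ^ (2 * k) * (fact (2 * k) * exp (real k))"
      using E l by (intro mult_left_mono) auto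
    also have "\<dots> = C * norm u ^ (2 * k)"
      by (simp add: C_def power_divide)
    finally show ?thesis .
  qed
  let ?m = "expectation (\<lambda>\<omega>. norm (Y \<omega>) ^ (2 * k))"
  define t where "t = 2 * \<nu> * (sqrt ?p + sqrt (2 * z))"
  have t: "t > 0" using \<nu> z by (auto simp: t_def intro!: mult_pos_pos add_nonneg_pos)
  have lk: "l ^ (2 * k) = 2 ^ k * real k ^ k / \<nu> ^ (2 * k)"
    unfolding power_mult l2 by (simp add: power_divide power_mult_distrib)
  have "fact (2 * k) / (2 ^ k * fact k) * ?m \<le> C * (2 ^ k * pochhammer (?p / 2) k)"
    by (rule expectation_norm_power_le[OF Y bdd C0 dir])
  also have "\<dots> \<le> C * (?p + real k) ^ k"
    using C0 by (intro mult_left_mono double_pochhammer_half_le) auto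
  finally have "?m \<le> 2 ^ k * fact k / fact (2 * k) * (C * (?p + real k) ^ k)"
    by (simp add: field_simps)
  \<comment> \<open>The factor (2k)! inside \<open>C\<close> cancels the one from the Gaussian
    moment; only k! remains.\<close>
  also have "\<dots> = fact k * exp (real k) / real k ^ k * (\<nu> ^ (2 * k) * (?p + real k) ^ k)"
    using k1 \<nu> unfolding C_def lk by (simp add: divide_simps)
  also have "\<dots> \<le> fact k * exp (real k) / real k ^ k * (t ^ (2 * k) / 4 ^ k)"
  proof (intro mult_left_mono)
    \<comment> \<open>Since p + k <= p + 2z <= (sqrt p + sqrt (2z))^2, the factor 2 in
      \<open>t\<close> yields the 4^k that makes the Markov bound decay.\<close>
    have "\<nu>\<^sup>2 * (?p + real k) \<le> \<nu>\<^sup>2 * (sqrt ?p + sqrt (2 * z))\<^sup>2"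
      using kz z by (intro mult_left_mono) (auto simp: power2_sum intro: order_trans)
    also have "\<dots> = t\<^sup>2 / 4" by (simp add: t_def power_mult_distrib)
    finally have "(\<nu>\<^sup>2 * (?p + real k)) ^ k \<le> (t\<^sup>2 / 4) ^ k"
      by (intro power_mono) auto
    then show "\<nu> ^ (2 * k) * (?p + real k) ^ k \<le> t ^ (2 * k) / 4 ^ k"
      by (simp add: power_mult power_mult_distrib power_divide)
  qed simp
  also have "\<dots> = fact k * exp (real k) / (4 * real k) ^ k * t ^ (2 * k)"
    by (simp add: power_mult_distrib)
  finally have m_le: "?m \<le> fact k * exp (real k) / (4 * real k) ^ k * t ^ (2 * k)" .
  have "prob {\<omega> \<in> space M. norm (Y \<omega>) \<ge> t} \<le> prob {\<omega> \<in> space M. norm (Y \<omega>) ^ (2 * k) \<ge> t ^ (2 * k)}"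
    using t by (intro finite_measure_mono) (auto intro!: power_mono)
  also have "\<dots> \<le> ?m / t ^ (2 * k)"
  proof (rule integral_Markov_inequality_measure[where A = "space M"])
    show "integrable M (\<lambda>\<omega>. norm (Y \<omega>) ^ (2 * k))"
      using bdd by (intro integrable_const_bound[where B = "B ^ (2 * k)"]) (auto intro!: power_mono)
  qed (use t in auto)
  also have "\<dots> \<le> fact k * exp (real k) / (4 * real k) ^ k"
    using m_le t by (simp add: pos_divide_le_eq)
  also have "\<dots> \<le> 2 * exp (- (real k + 1) / 2)"
    by (rule fact_exp_over_power_le[OF k1])
  also have "\<dots> \<le> 2 * exp (- z)"
    using zk by simp
  finally show ?thesis unfolding t_def .
qed

text \<open>Averaging the bound over s and -s gives 1 + y E(Y^2) <= exp(c y) with y = s^2/2.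
  Equality holds at y = 0, so comparing the right derivatives there gives the claim. It serves to
  derive \<open>\<nu>0 \<ge> 1\<close> from (ED0).\<close>

lemma (in prob_space) mgf_bound_ge_variance:
  fixes Y :: "'a \<Rightarrow> real"
  assumes Y [measurable]: "Y \<in> borel_measurable M" and bdd: "\<And>\<omega>. \<omega> \<in> space M \<Longrightarrow> \<bar>Y \<omega>\<bar> \<le> B"
    and mgf: "\<And>s. \<bar>s\<bar> \<le> g \<Longrightarrow> expectation (\<lambda>\<omega>. exp (s * Y \<omega>)) \<le> exp (c * s\<^sup>2 / 2)"
    and g: "g > 0"
  shows "expectation (\<lambda>\<omega>. (Y \<omega>)\<^sup>2) \<le> c"
proof (rule ccontr)
  let ?m = "expectation (\<lambda>\<omega>. (Y \<omega>)\<^sup>2)"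
  assume "\<not> ?m \<le> c"
  then have mc: "c < ?m" by simp
  have int_exp: "integrable M (\<lambda>\<omega>. exp (s * Y \<omega>))" for s
  proof (rule integrable_const_bound[where B = "exp (\<bar>s\<bar> * B)"])
    show "AE \<omega> in M. norm (exp (s * Y \<omega>)) \<le> exp (\<bar>s\<bar> * B)"
    proof (rule AE_I2)
      fix \<omega> assume "\<omega> \<in> space M"
      then have "\<bar>s\<bar> * \<bar>Y \<omega>\<bar> \<le> \<bar>s\<bar> * B" using bdd[of \<omega>] by (intro mult_left_mono) auto
      then show "norm (exp (s * Y \<omega>)) \<le> exp (\<bar>s\<bar> * B)" by (simp flip: abs_mult)
    qed
  qed simp
  have int_sq: "integrable M (\<lambda>\<omega>. (Y \<omega>)\<^sup>2)"
    using bdd by (intro integrable_const_bound[where B = "B\<^sup>2"]) (auto intro!: AE_I2 power2_le_iff_abs_le[THEN iffD2] order_trans[OF abs_ge_zero])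
  have key: "1 + y * ?m \<le> exp (c * y)" if y: "0 \<le> y" "2 * y \<le> g\<^sup>2" for y
  proof -
    define s where "s = sqrt (2 * y)"
    have s: "s\<^sup>2 = 2 * y" "\<bar>s\<bar> \<le> g" using y g by (auto simp: s_def intro!: real_le_lsqrt)
    have ce: "cosh (s * Y \<omega>) = (exp (s * Y \<omega>) + exp ((- s) * Y \<omega>)) / 2" for \<omega>
      by (simp add: cosh_field_def)
    have int_cosh: "integrable M (\<lambda>\<omega>. cosh (s * Y \<omega>))"
      unfolding ce using int_exp by (intro integrable_divide Bochner_Integration.integrable_add)
    have "1 + y * ?m = expectation (\<lambda>\<omega>. 1 + (s * Y \<omega>)\<^sup>2 / 2)"
      using int_sq s by (simp add: power_mult_distrib prob_space)
    also have "\<dots> \<le> expectation (\<lambda>\<omega>. cosh (s * Y \<omega>))"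
      using int_sq int_cosh by (intro integral_mono one_plus_half_square_le_cosh) (auto simp: power_mult_distrib)
    also have "\<dots> = (expectation (\<lambda>\<omega>. exp (s * Y \<omega>)) + expectation (\<lambda>\<omega>. exp ((- s) * Y \<omega>))) / 2"
      unfolding ce using int_exp[of s] int_exp[of "- s"] by simp
    also have "\<dots> \<le> exp (c * s\<^sup>2 / 2)"
      using mgf[of s] mgf[of "- s"] s by simp
    also have "\<dots> = exp (c * y)" by (simp add: s)
    finally show ?thesis .
  qed
  have "((\<lambda>y. exp (c * y)) has_real_derivative c) (at 0)"
    by (auto intro!: derivative_eq_intros)
  then have "((\<lambda>y. exp (c * y) - (1 + y * ?m)) has_real_derivative c - ?m) (at 0)"
    by (auto intro!: derivative_eq_intros)
  from DERIV_neg_dec_right[OF this] mc obtain d where d: "d > 0"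
    "\<And>h. 0 < h \<Longrightarrow> h < d \<Longrightarrow> exp (c * h) - (1 + h * ?m) < 0"
    by auto
  define y where "y = min (d / 2) (g\<^sup>2 / 2)"
  have "0 < y" "y < d" "2 * y \<le> g\<^sup>2" using d g by (auto simp: y_def)
  then show False using key[of y] d(2)[of y] by auto
qed

section \<open>Inversion of a monotone gradient map\<close>

lemma abs_exp_remainder_le:
  fixes x :: real
  assumes "\<bar>x\<bar> \<le> 1"
  shows "\<bar>exp x - 1 - x\<bar> \<le> x\<^sup>2"
proof (cases "x \<ge> 0")
  case True
  then show ?thesis using assms exp_bound[of x] exp_ge_add_one_self[of x] zero_le_power2[of x]
    unfolding abs_le_iff by linarith
next
  case False
  define y where "y = - x"
  have y: "0 < y" "y \<le> 1" using False assms by (auto simp: y_def)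
  have "exp (- y) \<le> 1 / (1 + y)"
    using y exp_ge_add_one_self[of y] by (simp add: exp_minus field_simps)
  \<comment> \<open>Here (1 + y)(1 - y + y^2) = 1 + y^3.\<close>
  also have "\<dots> \<le> 1 - y + y\<^sup>2"
    using y by (simp add: field_simps power2_eq_square)
  finally show ?thesis using exp_ge_add_one_self[of x] zero_le_power2[of x]
    unfolding y_def abs_le_iff power2_minus minus_minus by linarith
qed

lemma integrable_mult_bounded:
  fixes q w :: "'a \<Rightarrow> real"
  assumes q: "integrable N q" and w [measurable]: "w \<in> borel_measurable N" and bdd: "\<And>t. \<bar>w t\<bar> \<le> C"
  shows "integrable N (\<lambda>t. q t * w t)"
proof (rule Bochner_Integration.integrable_bound)
  have [measurable]: "q \<in> borel_measurable N" using q by simp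
  show "integrable N (\<lambda>t. C * q t)" using q by simp
  show "(\<lambda>t. q t * w t) \<in> borel_measurable N" by simp
  have "C \<ge> 0" using bdd abs_ge_zero order_trans by blast
  then show "AE t in N. norm (q t * w t) \<le> norm (C * q t)"
    using bdd by (auto simp: abs_mult mult.commute[of "\<bar>q _\<bar>"] intro!: mult_right_mono)
qed

text \<open>The second-order remainder of exp is bounded uniformly in t because \<Psi> is bounded,
  so the error in the difference quotient is linear in the increment. The factor \<open>q\<close>
  may be signed: the lemma is applied to the kernel weight and again to that weight times a
  projection of \<open>Psi\<close>.\<close>

lemma has_derivative_integral_exp_inner:
  fixes q :: "'a \<Rightarrow> real" and \<Psi> :: "'a \<Rightarrow> 'b::euclidean_space"
  assumes q: "integrable N q" and \<Psi> [measurable]: "\<Psi> \<in> borel_measurable N" and bdd: "\<And>t. norm (\<Psi> t) \<le> B"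
  shows "((\<lambda>\<theta>. \<integral>t. q t * exp (\<Psi> t \<bullet> \<theta>) \<partial>N) has_derivative
      (\<lambda>v. \<integral>t. q t * (\<Psi> t \<bullet> v) * exp (\<Psi> t \<bullet> \<theta>) \<partial>N)) (at \<theta>)"
proof -
  have B: "B \<ge> 0" using bdd norm_ge_zero order_trans by blast
  have inner_le: "\<bar>\<Psi> t \<bullet> v\<bar> \<le> B * norm v" for t v
    using bdd[of t] by (meson Cauchy_Schwarz_ineq2 mult_right_mono norm_ge_zero order_trans)
  have int_exp: "integrable N (\<lambda>t. q t * exp (\<Psi> t \<bullet> \<eta>))" for \<eta>
  proof (rule integrable_mult_bounded[OF q])
    show "\<bar>exp (\<Psi> t \<bullet> \<eta>)\<bar> \<le> exp (B * norm \<eta>)" for t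
      using inner_le[of t \<eta>] by simp
  qed simp
  define q' where "q' = (\<lambda>t. q t * exp (\<Psi> t \<bullet> \<theta>))"
  have q': "integrable N q'" unfolding q'_def by (rule int_exp)
  have int_inner: "integrable N (\<lambda>t. q' t * (\<Psi> t \<bullet> v))" for v
    using inner_le by (intro integrable_mult_bounded[OF q']) auto
  define A where "A = (\<integral>t. \<bar>q' t\<bar> \<partial>N)"
  let ?f = "\<lambda>\<theta>. \<integral>t. q t * exp (\<Psi> t \<bullet> \<theta>) \<partial>N"
  let ?f' = "\<lambda>v. \<integral>t. q' t * (\<Psi> t \<bullet> v) \<partial>N"
  have lin: "bounded_linear ?f'"
  proof (rule bounded_linear_intro[where K = "A * B"])
    show "?f' (v + w) = ?f' v + ?f' w" for v w
      using int_inner by (simp add: inner_add_right ring_distribs)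
    show "?f' (r *\<^sub>R v) = r *\<^sub>R ?f' v" for r v
      by (simp add: mult.left_commute)
    show "norm (?f' v) \<le> norm v * (A * B)" for v
    proof -
      have "norm (?f' v) \<le> (\<integral>t. norm (q' t * (\<Psi> t \<bullet> v)) \<partial>N)"
        by (rule integral_norm_bound)
      also have "\<dots> \<le> (\<integral>t. \<bar>q' t\<bar> * (B * norm v) \<partial>N)"
        using int_inner[of v] q' inner_le
        by (intro integral_mono integrable_norm) (auto simp: abs_mult intro!: mult_left_mono integrable_mult_left)
      finally show ?thesis by (simp add: A_def mult_ac)
    qed
  qed
  \<comment> \<open>The radius 1/(B + 1) keeps the exponent within [-1, 1], the range of the
    remainder bound, and stays meaningful when B = 0.\<close>
  have rem: "norm (?f y - ?f \<theta> - ?f' (y - \<theta>)) / norm (y - \<theta>) \<le> A * B\<^sup>2 * norm (y - \<theta>)"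
    if y: "y \<noteq> \<theta>" "dist y \<theta> < 1 / (B + 1)" for y
  proof -
    define h where "h = y - \<theta>"
    have h: "norm h > 0" "norm h < 1 / (B + 1)" using y by (auto simp: h_def dist_norm)
    have "(B + 1) * norm h < 1" using h B by (simp add: field_simps)
    then have Bh: "B * norm h \<le> 1" by (simp add: algebra_simps) (smt (verit) norm_ge_zero)
    have y_eq: "y = \<theta> + h" by (simp add: h_def)
    have eq: "q t * exp (\<Psi> t \<bullet> y) - q' t - q' t * (\<Psi> t \<bullet> h) = q' t * (exp (\<Psi> t \<bullet> h) - 1 - \<Psi> t \<bullet> h)" for t
      by (simp add: q'_def y_eq inner_add_right exp_add algebra_simps)
    have int_rem: "integrable N (\<lambda>t. q' t * (exp (\<Psi> t \<bullet> h) - 1 - \<Psi> t \<bullet> h))"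
      unfolding eq[symmetric] using int_exp q' int_inner by (intro Bochner_Integration.integrable_diff)
    have "?f y - ?f \<theta> - ?f' h = (\<integral>t. q' t * (exp (\<Psi> t \<bullet> h) - 1 - \<Psi> t \<bullet> h) \<partial>N)"
      unfolding eq[symmetric] using int_exp[of y] q' int_inner[of h] by (simp add: q'_def)
    also have "norm \<dots> \<le> (\<integral>t. norm (q' t * (exp (\<Psi> t \<bullet> h) - 1 - \<Psi> t \<bullet> h)) \<partial>N)"
      by (rule integral_norm_bound)
    also have "\<dots> \<le> (\<integral>t. \<bar>q' t\<bar> * (B * norm h)\<^sup>2 \<partial>N)"
    proof (rule integral_mono)
      show "integrable N (\<lambda>t. norm (q' t * (exp (\<Psi> t \<bullet> h) - 1 - \<Psi> t \<bullet> h)))"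
        using int_rem by (rule integrable_norm)
      show "integrable N (\<lambda>t. \<bar>q' t\<bar> * (B * norm h)\<^sup>2)"
        using q' by (intro integrable_mult_left) auto
      fix t
      have "\<bar>exp (\<Psi> t \<bullet> h) - 1 - \<Psi> t \<bullet> h\<bar> \<le> (\<Psi> t \<bullet> h)\<^sup>2"
        using inner_le[of t h] Bh by (intro abs_exp_remainder_le) simp
      also have "\<dots> \<le> (B * norm h)\<^sup>2"
        using inner_le[of t h] by (metis abs_ge_zero power2_abs power_mono)
      finally show "norm (q' t * (exp (\<Psi> t \<bullet> h) - 1 - \<Psi> t \<bullet> h)) \<le> \<bar>q' t\<bar> * (B * norm h)\<^sup>2"
        by (simp add: abs_mult mult_left_mono)
    qed
    also have "\<dots> = A * B\<^sup>2 * norm h * norm h"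
      by (simp add: A_def power2_eq_square mult_ac)
    finally show ?thesis using h by (simp add: h_def[symmetric] pos_divide_le_eq)
  qed
  have "(?f has_derivative ?f') (at \<theta>)"
  proof (rule has_derivativeI_sandwich[where e = "1 / (B + 1)" and H = "\<lambda>y. A * B\<^sup>2 * norm (y - \<theta>)"])
    show "((\<lambda>y. A * B\<^sup>2 * norm (y - \<theta>)) \<longlongrightarrow> 0) (at \<theta>)"
      by (auto intro!: tendsto_eq_intros)
  qed (use B lin rem in auto)
  then show ?thesis by (simp add: q'_def mult_ac)
qed

section \<open>Symmetric matrices, inverses and the Loewner order\<close>

lemma sym_mat_inner: "sym_mat A \<Longrightarrow> (A *v x) \<bullet> y = x \<bullet> (A *v y)"
  using transpose_matrix_vector[of A x] by (simp add: sym_mat_def dot_lmul_matrix)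

lemma pos_def_invertible: "pos_def A \<Longrightarrow> invertible A"
proof -
  assume A: "pos_def A"
  have "x = 0" if "A *v x = 0" for x
    using A that unfolding pos_def_def by (metis inner_zero_right less_irrefl)
  then show ?thesis
    by (simp add: invertible_left_inverse matrix_left_invertible_ker)
qed

lemma matrix_inv_vec [simp]:
  fixes A :: "real^'p^'p"
  assumes "invertible A"
  shows "matrix_inv A *v (A *v x) = x" "A *v (matrix_inv A *v x) = x"
proof -
  have "A ** matrix_inv A = mat 1 \<and> matrix_inv A ** A = mat 1"
    using assms unfolding invertible_def matrix_inv_def by (rule someI_ex)
  then show "matrix_inv A *v (A *v x) = x" "A *v (matrix_inv A *v x) = x"
    by (simp_all add: matrix_vector_mul_assoc)
qed

lemma sym_mat_inner_inv:
  assumes "sym_mat A" "invertible A"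
  shows "(matrix_inv A *v x) \<bullet> y = x \<bullet> (matrix_inv A *v y)"
proof -
  have "(matrix_inv A *v x) \<bullet> y = (matrix_inv A *v x) \<bullet> (A *v (matrix_inv A *v y))"
    using assms by simp
  also have "\<dots> = (A *v (matrix_inv A *v x)) \<bullet> (matrix_inv A *v y)"
    by (rule sym_mat_inner[OF assms(1), symmetric])
  finally show ?thesis using assms by simp
qed

text \<open>The Loewner bound says that V D^(-1) has operator norm at most a. Its transpose D^(-1) V
  then satisfies the same bound, and is applied to V^(-1) x.\<close>

lemma norm_inv_le_of_loewner_le:
  fixes D V :: "real^'p^'p"
  assumes D: "sym_mat D" "invertible D" and V: "sym_mat V" "invertible V"
    and a: "a > 0" and le: "loewner_le (V ** V) (a\<^sup>2 *\<^sub>R (D ** D))"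
  shows "norm (matrix_inv D *v x) \<le> a * norm (matrix_inv V *v x)"
proof -
  have adj: "norm (V *v (matrix_inv D *v e)) \<le> a * norm e" for e
  proof -
    define y where "y = matrix_inv D *v e"
    have "0 \<le> a\<^sup>2 * (y \<bullet> (D *v (D *v y))) - y \<bullet> (V *v (V *v y))"
      using le[unfolded loewner_le_def, rule_format, of y]
      by (simp only: matrix_vector_mult_diff_rdistrib scaleR_matrix_vector_assoc[symmetric] inner_diff_right
          matrix_vector_mul_assoc[symmetric] inner_scaleR_right)
    also have "y \<bullet> (D *v (D *v y)) = (norm e)\<^sup>2"
      using D by (simp add: y_def sym_mat_inner[symmetric] power2_norm_eq_inner)
    also have "y \<bullet> (V *v (V *v y)) = (norm (V *v y))\<^sup>2"
      using V by (simp add: sym_mat_inner[symmetric] power2_norm_eq_inner)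
    finally have "(norm (V *v y))\<^sup>2 \<le> (a * norm e)\<^sup>2" by (simp add: power_mult_distrib)
    then show ?thesis unfolding y_def by (rule power2_le_imp_le) (use a in simp)
  qed
  define w where "w = matrix_inv D *v x"
  define y where "y = matrix_inv V *v x"
  have x: "x = V *v y" using V by (simp add: y_def)
  have "(norm w)\<^sup>2 = w \<bullet> (matrix_inv D *v (V *v y))"
    by (simp add: w_def x power2_norm_eq_inner)
  also have "\<dots> = (V *v (matrix_inv D *v w)) \<bullet> y"
    using D V by (simp add: sym_mat_inner_inv[symmetric] sym_mat_inner)
  also have "\<dots> \<le> norm (V *v (matrix_inv D *v w)) * norm y"
    by (rule norm_cauchy_schwarz)
  also have "\<dots> \<le> a * norm w * norm y"
    using adj by (intro mult_right_mono) auto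
  finally have "norm w * norm w \<le> (a * norm y) * norm w"
    by (simp add: power2_eq_square mult_ac)
  then show ?thesis unfolding w_def[symmetric] y_def[symmetric]
    using a by (cases "norm w = 0") (auto simp: mult_le_cancel_right)
qed

text \<open>In the coordinates u = D(\<theta>1 - \<theta>0), the Jacobian of \<open>F\<close> is
  within \<delta> of the identity on the ball of radius r and positive semidefinite everywhere.
  \<open>deriv\<close> is stated for scalar projections along lines, so that the one-dimensional
  mean value theorem suffices.\<close>

lemma monotone_map_inversion_near_point:
  fixes F :: "real^'p \<Rightarrow> real^'p" and H :: "real^'p \<Rightarrow> real^'p^'p"
  assumes deriv: "\<And>b \<theta> w s. ((\<lambda>s. b \<bullet> F (\<theta> + s *\<^sub>R w)) has_real_derivative
        b \<bullet> (H (\<theta> + s *\<^sub>R w) *v w)) (at s)"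
    and psd: "\<And>\<theta> x. 0 \<le> x \<bullet> (H \<theta> *v x)"
    and D: "sym_mat D" "invertible D"
    and near: "\<And>\<theta>. norm (D *v (\<theta> - \<theta>0)) \<le> r \<Longrightarrow>
        opnorm (mat 1 - matrix_inv D ** H \<theta> ** matrix_inv D) \<le> \<delta>"
    and r: "r > 0" and \<delta>: "\<delta> \<ge> 0"
    and small: "norm (matrix_inv D *v (F \<theta>1 - F \<theta>0)) < r * (1 - \<delta>)"
  shows "norm (D *v (\<theta>1 - \<theta>0)) \<le> r"
    and "norm (D *v (\<theta>1 - \<theta>0) - matrix_inv D *v (F \<theta>1 - F \<theta>0)) \<le> r * \<delta>"
proof -
  define w where "w = \<theta>1 - \<theta>0"
  define u where "u = D *v w"
  define x where "x = matrix_inv D *v (F \<theta>1 - F \<theta>0)"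
  define N where "N = (\<lambda>\<theta>. matrix_inv D ** H \<theta> ** matrix_inv D)"
  have t1: "\<theta>1 = \<theta>0 + 1 *\<^sub>R w" by (simp add: w_def)
  have Hw: "(matrix_inv D *v e) \<bullet> (H \<theta> *v w) = e \<bullet> (N \<theta> *v u)" for e \<theta>
    using D by (simp add: N_def u_def sym_mat_inner_inv matrix_vector_mul_assoc[symmetric])
  have mvt: "\<exists>\<sigma>. 0 < \<sigma> \<and> \<sigma> < s \<and> e \<bullet> (matrix_inv D *v (F (\<theta>0 + s *\<^sub>R w) - F \<theta>0)) =
      s * (e \<bullet> (N (\<theta>0 + \<sigma> *\<^sub>R w) *v u))" if s: "s > 0" for s e
    using MVT2[OF s, of "\<lambda>s. (matrix_inv D *v e) \<bullet> F (\<theta>0 + s *\<^sub>R w)", OF deriv] D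
    by (auto simp: Hw inner_diff_right[symmetric] sym_mat_inner_inv matrix_vector_mult_diff_distrib)
  have N_le: "norm (v - N \<theta> *v v) \<le> \<delta> * norm v" if "norm (D *v (\<theta> - \<theta>0)) \<le> r" for \<theta> v
  proof -
    have "norm ((mat 1 - N \<theta>) *v v) \<le> opnorm (mat 1 - N \<theta>) * norm v"
      unfolding opnorm_def by (rule onorm) (rule matrix_vector_mul_bounded_linear)
    also have "\<dots> \<le> \<delta> * norm v"
      using near[OF that] by (intro mult_right_mono) (auto simp: N_def)
    finally show ?thesis by (simp add: matrix_vector_mult_diff_rdistrib)
  qed
  have on_line: "norm (D *v ((\<theta>0 + \<sigma> *\<^sub>R w) - \<theta>0)) \<le> r" if "0 < \<sigma>" "\<sigma> * norm u \<le> r" for \<sigma>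
    using that by (simp add: u_def matrix_vector_mult_scaleR)
  show ball: "norm (D *v (\<theta>1 - \<theta>0)) \<le> r"
  proof (rule ccontr)
    assume "\<not> ?thesis"
    then have ur: "norm u > r" by (simp add: u_def w_def)
    \<comment> \<open>The point \<theta>0 + s w is where the segment leaves the ball; (L0) controls
      the increment up to it and monotonicity controls the rest.\<close>
    define s where "s = r / norm u"
    have s: "0 < s" "s < 1" "s * norm u = r" using ur r by (auto simp: s_def divide_simps)
    obtain \<sigma> where \<sigma>: "0 < \<sigma>" "\<sigma> < s"
      and eq: "u \<bullet> (matrix_inv D *v (F (\<theta>0 + s *\<^sub>R w) - F \<theta>0)) = s * (u \<bullet> (N (\<theta>0 + \<sigma> *\<^sub>R w) *v u))"
      using mvt[OF s(1), of u] by auto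
    have "\<sigma> * norm u \<le> s * norm u" using \<sigma> by (intro mult_right_mono) auto
    then have "norm (u - N (\<theta>0 + \<sigma> *\<^sub>R w) *v u) \<le> \<delta> * norm u"
      using \<sigma> s by (intro N_le on_line) auto
    then have "u \<bullet> (u - N (\<theta>0 + \<sigma> *\<^sub>R w) *v u) \<le> norm u * (\<delta> * norm u)"
      by (meson norm_cauchy_schwarz mult_left_mono norm_ge_zero order_trans)
    then have "(1 - \<delta>) * (norm u)\<^sup>2 \<le> u \<bullet> (N (\<theta>0 + \<sigma> *\<^sub>R w) *v u)"
      by (simp add: inner_diff_right power2_norm_eq_inner[symmetric] power2_eq_square algebra_simps)
    then have "s * ((1 - \<delta>) * (norm u)\<^sup>2) \<le> u \<bullet> (matrix_inv D *v (F (\<theta>0 + s *\<^sub>R w) - F \<theta>0))"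
      unfolding eq using s by (intro mult_left_mono) auto
    also have "\<dots> = w \<bullet> F (\<theta>0 + s *\<^sub>R w) - w \<bullet> F \<theta>0"
      using D by (simp add: u_def sym_mat_inner inner_diff_right)
    also have "\<dots> \<le> w \<bullet> F (\<theta>0 + 1 *\<^sub>R w) - w \<bullet> F \<theta>0"
    proof -
      have "w \<bullet> F (\<theta>0 + s *\<^sub>R w) \<le> w \<bullet> F (\<theta>0 + 1 *\<^sub>R w)"
        using s(2) by (intro DERIV_nonneg_imp_nondecreasing[of s 1 "\<lambda>s. w \<bullet> F (\<theta>0 + s *\<^sub>R w)"])
          (auto intro!: deriv psd exI)
      then show ?thesis by simp
    qed
    also have "\<dots> = w \<bullet> (D *v x)"
      using D unfolding t1[symmetric] by (simp add: x_def inner_diff_right)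
    also have "\<dots> = u \<bullet> x"
      unfolding u_def by (rule sym_mat_inner[OF D(1), symmetric])
    also have "\<dots> \<le> norm u * norm x" by (rule norm_cauchy_schwarz)
    also have "\<dots> < norm u * (r * (1 - \<delta>))"
      using small ur r by (intro mult_strict_left_mono) (auto simp: x_def)
    also have "\<dots> = s * ((1 - \<delta>) * (norm u)\<^sup>2)"
      by (simp add: s(3)[symmetric] power2_eq_square)
    finally show False by simp
  qed
  \<comment> \<open>The mean value point depends on the test vector. Testing against the error
    itself makes the scalar identity a bound on the squared norm of the error.\<close>
  define e where "e = u - x"
  obtain \<sigma> where \<sigma>: "0 < \<sigma>" "\<sigma> < 1" and eq: "e \<bullet> x = e \<bullet> (N (\<theta>0 + \<sigma> *\<^sub>R w) *v u)"
    using mvt[of 1 e] unfolding t1[symmetric] x_def[symmetric] by auto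
  have ur: "norm u \<le> r" using ball by (simp add: u_def w_def)
  have "\<sigma> * norm u \<le> 1 * norm u" using \<sigma> by (intro mult_right_mono) auto
  then have le: "norm (u - N (\<theta>0 + \<sigma> *\<^sub>R w) *v u) \<le> \<delta> * norm u"
    using \<sigma> ur by (intro N_le on_line) auto
  have "norm e * norm e = e \<bullet> (u - N (\<theta>0 + \<sigma> *\<^sub>R w) *v u)"
  proof -
    have "norm e * norm e = e \<bullet> e" by (simp add: dot_square_norm power2_eq_square)
    also have "\<dots> = e \<bullet> u - e \<bullet> x" by (simp add: e_def inner_diff_right)
    finally show ?thesis by (simp add: eq inner_diff_right)
  qed
  also have "\<dots> \<le> norm e * (\<delta> * norm u)"
    using le by (meson norm_cauchy_schwarz mult_left_mono norm_ge_zero order_trans)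
  finally have "norm e \<le> \<delta> * norm u"
    using \<delta> by (cases "norm e = 0") (auto simp: mult_le_cancel_left)
  also have "\<dots> \<le> \<delta> * r" using ur \<delta> by (rule mult_left_mono)
  finally show "norm (D *v (\<theta>1 - \<theta>0) - matrix_inv D *v (F \<theta>1 - F \<theta>0)) \<le> r * \<delta>"
    by (simp add: e_def u_def x_def w_def mult.commute)
qed

section \<open>The local likelihood\<close>

lemma grad_at_eqI:
  assumes "(F has_derivative (\<lambda>v. g \<bullet> v)) (at x)"
  shows "grad_at F x = g"
  unfolding grad_at_def
proof (rule the_equality[where P = "\<lambda>g. (F has_derivative (\<lambda>v. g \<bullet> v)) (at x)", OF assms])
  fix g' assume "(F has_derivative (\<lambda>v. g' \<bullet> v)) (at x)"
  from has_derivative_unique[OF this assms] have "g' \<bullet> v = g \<bullet> v" for v by metis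
  then show "g' = g" using vector_eq_rdot by blast
qed

lemma derivative_zero_at_max:
  fixes F :: "'a::real_inner \<Rightarrow> real"
  assumes "(F has_derivative (\<lambda>v. g \<bullet> v)) (at x)" and "\<And>y. F y \<le> F x"
  shows "g = 0"
proof -
  have "(\<lambda>v. g \<bullet> v) = (\<lambda>v. 0)"
    using assms by (intro differential_zero_maxmin[of x UNIV]) auto
  then have "g \<bullet> g = 0" by metis
  then show ?thesis by simp
qed

lemma inner_matrix_vec_sum:
  fixes A :: "real^'p^'q"
  shows "b \<bullet> (A *v w) = (\<Sum>j\<in>UNIV. \<Sum>k\<in>UNIV. b $ j * w $ k * A $ j $ k)"
  by (simp add: inner_vec_def matrix_vector_mult_def sum_distrib_left mult_ac)

lemma inner_mult_sum:
  fixes v b w :: "real^'p"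
  shows "(v \<bullet> b) * (v \<bullet> w) = (\<Sum>j\<in>UNIV. \<Sum>k\<in>UNIV. b $ j * w $ k * (v $ j * v $ k))"
  by (simp add: inner_vec_def sum_product mult_ac)

lemma (in prob_space) covmat_quadratic:
  fixes G :: "'a \<Rightarrow> real^'p"
  assumes G [measurable]: "G \<in> borel_measurable M" and bdd: "\<And>\<omega>. norm (G \<omega>) \<le> B"
    and centred: "\<And>j. expectation (\<lambda>\<omega>. G \<omega> $ j) = 0"
  shows "x \<bullet> (covmat M G *v x) = expectation (\<lambda>\<omega>. (x \<bullet> G \<omega>)\<^sup>2)"
proof -
  have [measurable]: "(\<lambda>\<omega>. G \<omega> $ j) \<in> borel_measurable M" for j
    using measurable_compose[OF G borel_measurable_nth] by simp
  have int: "integrable M (\<lambda>\<omega>. G \<omega> $ j * G \<omega> $ k)" for j k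
  proof (rule integrable_const_bound[where B = "B * B"])
    have "\<bar>G \<omega> $ j\<bar> \<le> B" for \<omega> j using component_le_norm_cart[of "G \<omega>" j] bdd[of \<omega>] by simp
    then show "AE \<omega> in M. norm (G \<omega> $ j * G \<omega> $ k) \<le> B * B"
      by (auto simp: abs_mult intro!: AE_I2 mult_mono order_trans[OF abs_ge_zero])
  qed simp
  have "expectation (\<lambda>\<omega>. (x \<bullet> G \<omega>)\<^sup>2) =
      expectation (\<lambda>\<omega>. \<Sum>j\<in>UNIV. \<Sum>k\<in>UNIV. x $ j * x $ k * (G \<omega> $ j * G \<omega> $ k))"
    by (simp add: power2_eq_square inner_commute[of x] inner_mult_sum)
  also have "\<dots> = (\<Sum>j\<in>UNIV. \<Sum>k\<in>UNIV. x $ j * x $ k * expectation (\<lambda>\<omega>. G \<omega> $ j * G \<omega> $ k))"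
    using int by (simp add: Bochner_Integration.integral_sum)
  also have "\<dots> = x \<bullet> (covmat M G *v x)"
    unfolding inner_matrix_vec_sum by (simp add: covmat_def centred)
  finally show ?thesis by simp
qed

text \<open>This collects the deterministic part of the model. The bounds are parameters so that
  integrability and differentiability can refer to fixed constants.\<close>

locale local_exp_model =
  fixes K :: "real^'d \<Rightarrow> real" and Psi :: "real^'d \<Rightarrow> real^'p" and n :: nat and h :: real
    and BK BP :: real
  assumes K_meas [measurable]: "K \<in> borel_measurable borel" and K_bdd: "\<And>t. \<bar>K t\<bar> \<le> BK"
    and K_nonneg: "\<And>t. 0 \<le> K t"
    and Psi_meas [measurable]: "Psi \<in> borel_measurable borel" and Psi_bdd: "\<And>t. norm (Psi t) \<le> BP"
    and h_pos: "h > 0"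
begin

text \<open>Absorbing the indicator turns the set integrals over the cube into plain integrals
  against an integrable weight.\<close>

definition weight :: "real^'d \<Rightarrow> real" where
  "weight t = indicator unit_cube t * K t"

definition sample_scale :: real where
  "sample_scale = real n * h ^ CARD('d)"

text \<open>This is the gradient of the convex term subtracted in \<open>loglik\<close>.\<close>

definition mean_map :: "real^'p \<Rightarrow> real^'p" where
  "mean_map \<theta> = (\<chi> j. sample_scale * (\<integral>t. weight t * Psi t $ j * exp (Psi t \<bullet> \<theta>) \<partial>lborel))"

lemma sample_scale_nonneg: "0 \<le> sample_scale"
  using h_pos by (simp add: sample_scale_def)

lemma integrable_weight: "integrable lborel weight"
proof (rule Bochner_Integration.integrable_bound)
  show "integrable lborel (\<lambda>t::real^'d. BK * indicator unit_cube t)"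
    unfolding unit_cube_def
    by (intro integrable_mult_right integrable_real_indicator emeasure_lborel_cbox_finite) simp
  have [measurable]: "(unit_cube :: (real^'d) set) \<in> sets borel" by (simp add: unit_cube_def)
  show "weight \<in> borel_measurable lborel" unfolding weight_def[abs_def] by simp
  show "AE t in lborel. norm (weight t) \<le> norm (BK * indicator unit_cube t)"
    using K_bdd order_trans[OF abs_ge_zero K_bdd] by (auto simp: weight_def indicator_def)
qed

lemma weight_nonneg: "0 \<le> weight t"
  by (simp add: weight_def K_nonneg)

lemma integrable_weight_mult:
  assumes "w \<in> borel_measurable borel" "\<And>t. \<bar>w t\<bar> \<le> C"
  shows "integrable lborel (\<lambda>t. weight t * w t)"
  using integrable_mult_bounded[OF integrable_weight, of w C] assms by simp

lemma abs_inner_Psi_le: "\<bar>Psi t \<bullet> v\<bar> \<le> BP * norm v"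
  using Psi_bdd[of t] by (meson Cauchy_Schwarz_ineq2 mult_right_mono norm_ge_zero order_trans)

lemma integrable_inner_exp: "integrable lborel (\<lambda>t. weight t * (Psi t \<bullet> b) * exp (Psi t \<bullet> \<theta>))"
proof -
  have "\<bar>(Psi t \<bullet> b) * exp (Psi t \<bullet> \<theta>)\<bar> \<le> (BP * norm b) * exp (BP * norm \<theta>)" for t
    unfolding abs_mult using abs_inner_Psi_le[of t b] abs_inner_Psi_le[of t \<theta>]
    by (intro mult_mono) auto
  from integrable_weight_mult[OF _ this] show ?thesis by (simp add: mult.assoc)
qed

lemma integrable_inner_inner_exp:
  "integrable lborel (\<lambda>t. weight t * (Psi t \<bullet> b) * (Psi t \<bullet> w) * exp (Psi t \<bullet> \<theta>))"
proof -
  have "\<bar>(Psi t \<bullet> b) * ((Psi t \<bullet> w) * exp (Psi t \<bullet> \<theta>))\<bar> \<le> (BP * norm b) * ((BP * norm w) * exp (BP * norm \<theta>))" for t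
    unfolding abs_mult using abs_inner_Psi_le[of t b] abs_inner_Psi_le[of t w] abs_inner_Psi_le[of t \<theta>]
    by (intro mult_mono) auto
  from integrable_weight_mult[OF _ this] show ?thesis by (simp add: mult.assoc)
qed

lemma inner_mean_map:
  "b \<bullet> mean_map \<theta> = sample_scale * (\<integral>t. weight t * (Psi t \<bullet> b) * exp (Psi t \<bullet> \<theta>) \<partial>lborel)"
proof -
  have int: "integrable lborel (\<lambda>t. weight t * Psi t $ j * exp (Psi t \<bullet> \<theta>))" for j
    using integrable_inner_exp[of "axis j 1" \<theta>] by (simp add: inner_axis)
  have "weight t * (Psi t \<bullet> b) * exp (Psi t \<bullet> \<theta>) =
      (\<Sum>j\<in>UNIV. b $ j * (weight t * Psi t $ j * exp (Psi t \<bullet> \<theta>)))" for t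
    by (simp add: inner_vec_def[of "Psi t" b] sum_distrib_left sum_distrib_right mult_ac)
  then have "(\<integral>t. weight t * (Psi t \<bullet> b) * exp (Psi t \<bullet> \<theta>) \<partial>lborel) =
      (\<Sum>j\<in>UNIV. b $ j * (\<integral>t. weight t * Psi t $ j * exp (Psi t \<bullet> \<theta>) \<partial>lborel))"
    using int by (simp add: Bochner_Integration.integral_sum)
  then show ?thesis
    by (simp add: inner_vec_def[of b] mean_map_def sum_distrib_left mult_ac)
qed

lemma inner_Dn2:
  "b \<bullet> (Dn2 K Psi n h \<theta> *v w) =
    sample_scale * (\<integral>t. weight t * (Psi t \<bullet> b) * (Psi t \<bullet> w) * exp (Psi t \<bullet> \<theta>) \<partial>lborel)"
proof -
  let ?f = "\<lambda>j k t. weight t * Psi t $ j * Psi t $ k * exp (Psi t \<bullet> \<theta>)"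
  have int: "integrable lborel (?f j k)" for j k
    using integrable_inner_inner_exp[of "axis j 1" "axis k 1" \<theta>] by (simp add: inner_axis)
  have "weight t * (Psi t \<bullet> b) * (Psi t \<bullet> w) * exp (Psi t \<bullet> \<theta>) =
      (\<Sum>j\<in>UNIV. \<Sum>k\<in>UNIV. b $ j * w $ k * ?f j k t)" for t
  proof -
    have "weight t * (Psi t \<bullet> b) * (Psi t \<bullet> w) * exp (Psi t \<bullet> \<theta>) =
        weight t * exp (Psi t \<bullet> \<theta>) * ((Psi t \<bullet> b) * (Psi t \<bullet> w))" by (simp add: mult_ac)
    also have "\<dots> = (\<Sum>j\<in>UNIV. \<Sum>k\<in>UNIV. b $ j * w $ k * ?f j k t)"
      unfolding inner_mult_sum by (simp add: sum_distrib_left mult_ac)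
    finally show ?thesis .
  qed
  then have "(\<integral>t. weight t * (Psi t \<bullet> b) * (Psi t \<bullet> w) * exp (Psi t \<bullet> \<theta>) \<partial>lborel) =
      (\<Sum>j\<in>UNIV. \<Sum>k\<in>UNIV. b $ j * w $ k * (\<integral>t. ?f j k t \<partial>lborel))"
    using int by (simp add: Bochner_Integration.integral_sum)
  moreover have "Dn2 K Psi n h \<theta> $ j $ k = sample_scale * (\<integral>t. ?f j k t \<partial>lborel)" for j k
    by (simp add: Dn2_def sample_scale_def set_lebesgue_integral_def weight_def mult.assoc)
  ultimately show ?thesis
    unfolding inner_matrix_vec_sum by (simp add: sum_distrib_left mult_ac)
qed

lemma Dn2_psd: "0 \<le> x \<bullet> (Dn2 K Psi n h \<theta> *v x)"
proof -
  have "0 \<le> weight t * (Psi t \<bullet> x) * (Psi t \<bullet> x) * exp (Psi t \<bullet> \<theta>)" for t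
    using weight_nonneg[of t] by (simp add: mult.assoc[of "weight t"])
  then show ?thesis
    unfolding inner_Dn2 by (simp add: sample_scale_nonneg)
qed

text \<open>For fixed \<open>b\<close>, the projection of \<open>mean_map\<close> is again an
  exponential integral, now with the signed weight \<open>weight t * (Psi t \<bullet> b)\<close>;
  differentiating it produces the quadratic form of \<open>Dn2\<close>.\<close>

lemma mean_map_line_derivative:
  "((\<lambda>s. b \<bullet> mean_map (\<theta> + s *\<^sub>R w)) has_real_derivative
     b \<bullet> (Dn2 K Psi n h (\<theta> + s *\<^sub>R w) *v w)) (at s)"
proof -
  have "integrable lborel (\<lambda>t. weight t * (Psi t \<bullet> b))"
    using abs_inner_Psi_le by (intro integrable_weight_mult) auto
  from has_derivative_integral_exp_inner[OF this _ Psi_bdd, where \<theta> = "\<theta> + s *\<^sub>R w"]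
  have "((\<lambda>\<theta>. \<integral>t. weight t * (Psi t \<bullet> b) * exp (Psi t \<bullet> \<theta>) \<partial>lborel) has_derivative
     (\<lambda>v. \<integral>t. weight t * (Psi t \<bullet> b) * (Psi t \<bullet> v) * exp (Psi t \<bullet> (\<theta> + s *\<^sub>R w)) \<partial>lborel)) (at (\<theta> + s *\<^sub>R w))"
    by simp
  moreover have "((\<lambda>s. \<theta> + s *\<^sub>R w) has_derivative (\<lambda>k. k *\<^sub>R w)) (at s)"
    by (auto intro!: derivative_eq_intros)
  ultimately have "((\<lambda>s. \<integral>t. weight t * (Psi t \<bullet> b) * exp (Psi t \<bullet> (\<theta> + s *\<^sub>R w)) \<partial>lborel) has_derivative
     (\<lambda>k. \<integral>t. weight t * (Psi t \<bullet> b) * (Psi t \<bullet> (k *\<^sub>R w)) * exp (Psi t \<bullet> (\<theta> + s *\<^sub>R w)) \<partial>lborel)) (at s)"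
    by (rule has_derivative_compose[rotated])
  then have "((\<lambda>s. sample_scale * (\<integral>t. weight t * (Psi t \<bullet> b) * exp (Psi t \<bullet> (\<theta> + s *\<^sub>R w)) \<partial>lborel)) has_derivative
     (\<lambda>k. sample_scale * (\<integral>t. weight t * (Psi t \<bullet> b) * (Psi t \<bullet> (k *\<^sub>R w)) * exp (Psi t \<bullet> (\<theta> + s *\<^sub>R w)) \<partial>lborel))) (at s)"
    by (rule has_derivative_mult_right)
  moreover have "sample_scale * (\<integral>t. weight t * (Psi t \<bullet> b) * (Psi t \<bullet> (k *\<^sub>R w)) * exp (Psi t \<bullet> (\<theta> + s *\<^sub>R w)) \<partial>lborel) =
      (b \<bullet> (Dn2 K Psi n h (\<theta> + s *\<^sub>R w) *v w)) * k" for k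
  proof -
    have "weight t * (Psi t \<bullet> b) * (Psi t \<bullet> (k *\<^sub>R w)) * exp (Psi t \<bullet> (\<theta> + s *\<^sub>R w)) =
        weight t * (Psi t \<bullet> b) * (Psi t \<bullet> w) * exp (Psi t \<bullet> (\<theta> + s *\<^sub>R w)) * k" for t
      by simp
    then show ?thesis
      unfolding inner_Dn2 by (simp only: integral_mult_left_zero flip: mult.assoc)
  qed
  ultimately show ?thesis
    unfolding has_field_derivative_def inner_mean_map by simp
qed

text \<open>The vector \<open>S\<close> is arbitrary, so the formula covers both the realised
  likelihood and its expectation.\<close>

lemma log_partition_derivative:
  "((\<lambda>\<theta>. S \<bullet> \<theta> - real n * h ^ CARD('d) * (\<integral>t\<in>unit_cube. K t * exp (Psi t \<bullet> \<theta>) \<partial>lborel))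
     has_derivative (\<lambda>v. (S - mean_map \<theta>) \<bullet> v)) (at \<theta>)"
proof -
  have "((\<lambda>\<theta>. \<integral>t. weight t * exp (Psi t \<bullet> \<theta>) \<partial>lborel) has_derivative
     (\<lambda>v. \<integral>t. weight t * (Psi t \<bullet> v) * exp (Psi t \<bullet> \<theta>) \<partial>lborel)) (at \<theta>)"
    by (rule has_derivative_integral_exp_inner[OF integrable_weight _ Psi_bdd]) simp
  then have "((\<lambda>\<theta>. S \<bullet> \<theta> - sample_scale * (\<integral>t. weight t * exp (Psi t \<bullet> \<theta>) \<partial>lborel)) has_derivative
     (\<lambda>v. S \<bullet> v - sample_scale * (\<integral>t. weight t * (Psi t \<bullet> v) * exp (Psi t \<bullet> \<theta>) \<partial>lborel))) (at \<theta>)"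
    by (intro has_derivative_diff has_derivative_mult_right has_derivative_inner_right has_derivative_ident)
  moreover have "S \<bullet> v - sample_scale * (\<integral>t. weight t * (Psi t \<bullet> v) * exp (Psi t \<bullet> \<theta>) \<partial>lborel) = (S - mean_map \<theta>) \<bullet> v" for v
    by (simp add: inner_diff_left inner_commute[of "mean_map \<theta>"] inner_mean_map)
  ultimately show ?thesis
    by (simp add: sample_scale_def weight_def set_lebesgue_integral_def mult.assoc)
qed

end

section \<open>Critical points, the deviation event and the expansion\<close>

theorem theorem2:
  fixes M :: "'w measure"
    and X :: "'w \<Rightarrow> nat \<Rightarrow> real^'d"
    and f :: "real^'d \<Rightarrow> real"
    and K :: "real^'d \<Rightarrow> real"
    and Psi :: "real^'d \<Rightarrow> real^'p"
    and i0 :: 'p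
    and n :: nat and h :: real and x0 :: "real^'d"
    and theta_t :: "'w \<Rightarrow> real^'p" and theta_s :: "real^'p"
    and D V :: "real^'p^'p"
    and a g \<nu>0 z \<delta> :: real
  defines "L \<equiv> loglik K Psi X n h x0"
      and "gradL \<equiv> (\<lambda>\<omega>. grad_at (\<lambda>\<theta>. loglik K Psi X n h x0 \<theta> \<omega>) theta_s)"
      and "r0 \<equiv> 4 * a * \<nu>0 * (sqrt (real CARD('p)) + sqrt (2 * z))"
      and "zeta_pz \<equiv> a * \<nu>0 * (sqrt (real CARD('p)) + sqrt (2 * z))"
  assumes M: "prob_space M"
    and n_pos: "n \<ge> 1" and h_pos: "h > 0"
    \<comment> \<open>X 0, ..., X (n-1): i.i.d. with Lebesgue density f\<close>
    and X_meas: "\<And>i. i < n \<Longrightarrow> (\<lambda>\<omega>. X \<omega> i) \<in> borel_measurable M"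
    and X_indep: "prob_space.indep_vars M (\<lambda>_. borel) (\<lambda>i \<omega>. X \<omega> i) {..<n}"
    and f_meas: "f \<in> borel_measurable lborel" and f_nonneg: "\<And>x. 0 \<le> f x"
    and X_distr: "\<And>i. i < n \<Longrightarrow> distributed M lborel (\<lambda>\<omega>. X \<omega> i) (\<lambda>x. ennreal (f x))"
    \<comment> \<open>kernel\<close>
    and K_meas: "K \<in> borel_measurable lborel"
    and K_bdd: "\<exists>B. \<forall>t. \<bar>K t\<bar> \<le> B"
    and K_nonneg: "\<And>t. 0 \<le> K t"
    and K_supp: "\<And>t. t \<notin> unit_cube \<Longrightarrow> K t = 0"
    \<comment> \<open>basis functions psi_0, ..., psi_{p-1}\<close>
    and Psi_meas: "Psi \<in> borel_measurable lborel"
    and Psi_bdd: "\<exists>B. \<forall>t. norm (Psi t) \<le> B"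
    and Psi_supp: "\<And>t. t \<notin> unit_cube \<Longrightarrow> Psi t = 0"
    and Psi0: "\<And>t. t \<in> unit_cube \<Longrightarrow> Psi t $ i0 = 1"
    and Psi_indep: "\<And>c. (\<forall>t. 0 < K t \<longrightarrow> c \<bullet> Psi t = 0) \<Longrightarrow> c = 0"
    \<comment> \<open>maximizers (assumed to exist)\<close>
    and theta_t_max: "\<And>\<omega> \<theta>. \<omega> \<in> space M \<Longrightarrow> L \<theta> \<omega> \<le> L (theta_t \<omega>) \<omega>"
    and theta_s_max: "\<And>\<theta>. (\<integral>\<omega>. L \<theta> \<omega> \<partial>M) \<le> (\<integral>\<omega>. L theta_s \<omega> \<partial>M)"
    \<comment> \<open>D_n = symmetric positive definite square root of D_n^2 = D_n^2(theta*)\<close>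
    and D_sym: "sym_mat D" and D_pd: "pos_def D" and D_sq: "D ** D = Dn2 K Psi n h theta_s"
    \<comment> \<open>V_n^2 = Var(grad L(theta*)) positive definite; V_n its symmetric p.d. square root\<close>
    and Vn2_pd: "pos_def (covmat M gradL)"
    and V_sym: "sym_mat V" and V_pd: "pos_def V" and V_sq: "V ** V = covmat M gradL"
    \<comment> \<open>condition (I)\<close>
    and a_pos: "a > 0"
    and cond_I: "loewner_le (covmat M gradL) (a\<^sup>2 *\<^sub>R Dn2 K Psi n h theta_s)"
    \<comment> \<open>condition (ED0)\<close>
    and g_pos: "g > 0" and nu0_pos: "\<nu>0 > 0"
    and cond_ED0: "\<And>\<gamma> lam. \<gamma> \<noteq> 0 \<Longrightarrow> \<bar>lam\<bar> \<le> g \<Longrightarrow>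
        ln (\<integral>\<omega>. exp (lam * (\<gamma> \<bullet> (matrix_inv V *v gradL \<omega> - (\<integral>\<omega>'. matrix_inv V *v gradL \<omega>' \<partial>M))) / norm \<gamma>) \<partial>M) \<le> \<nu>0\<^sup>2 * lam\<^sup>2 / 2"
    \<comment> \<open>condition (L0), with delta = delta_n(r0(z))\<close>
    and delta_nonneg: "\<delta> \<ge> 0"
    and cond_L0: "\<And>\<theta>. norm (D *v (\<theta> - theta_s)) \<le> r0 \<Longrightarrow>
        opnorm (mat 1 - matrix_inv D ** Dn2 K Psi n h \<theta> ** matrix_inv D) \<le> \<delta>"
    \<comment> \<open>condition (C)\<close>
    and cond_C: "r0 * (1 - \<delta>) \<ge> 2 * zeta_pz"
    \<comment> \<open>range of z\<close>
    and z_pos: "z > 0" and z_le: "z \<le> g\<^sup>2 / 4"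
  shows "\<exists>A \<in> sets M. measure M A \<ge> 1 - (2 * exp (- z) + 8.4 * exp (- g\<^sup>2 / 4)) \<and>
           (\<forall>\<omega> \<in> A. norm (D *v (theta_t \<omega> - theta_s)) \<le> r0 \<and> norm (D *v (theta_t \<omega> - theta_s) - matrix_inv D *v gradL \<omega>) \<le> r0 * \<delta>)"
proof -
  interpret prob_space M by (rule M)
  from K_bdd obtain BK where BK: "\<And>t. \<bar>K t\<bar> \<le> BK" by blast
  from Psi_bdd obtain BP where BP: "\<And>t. norm (Psi t) \<le> BP" by blast
  have [measurable]: "K \<in> borel_measurable borel" "Psi \<in> borel_measurable borel"
    using K_meas Psi_meas by simp_all
  interpret local_exp_model K Psi n h BK BP
    by unfold_locales (use BK BP K_nonneg h_pos in auto)
  define T where "T = (\<lambda>i \<omega>. rescale h x0 (X \<omega> i))"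
  \<comment> \<open>The sample enters the likelihood only through this bounded linear statistic; the
    subtracted term \<open>G\<close> is deterministic.\<close>
  define S where "S = (\<lambda>\<omega>. \<Sum>i<n. K (T i \<omega>) *\<^sub>R Psi (T i \<omega>))"
  define G where "G = (\<lambda>\<theta>. real n * h ^ CARD('d) * (\<integral>t\<in>unit_cube. K t * exp (Psi t \<bullet> \<theta>) \<partial>lborel))"
  have BK0: "BK \<ge> 0" using BK abs_ge_zero order_trans by blast
  have T_meas [measurable]: "T i \<in> borel_measurable M" if "i < n" for i
    using X_meas[OF that] unfolding T_def rescale_def by measurable
  have S_meas [measurable]: "S \<in> borel_measurable M"
    unfolding S_def by measurable
  have S_bdd: "norm (S \<omega>) \<le> real n * (BK * BP)" for \<omega>
  proof -
    have "norm (K (T i \<omega>) *\<^sub>R Psi (T i \<omega>)) \<le> BK * BP" for i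
      using BK BP BK0 by (auto intro!: mult_mono)
    then show ?thesis
      unfolding S_def using sum_norm_bound[of "{..<n}" "\<lambda>i. K (T i \<omega>) *\<^sub>R Psi (T i \<omega>)" "BK * BP"] by simp
  qed
  have S_int: "integrable M S"
    using S_bdd by (intro integrable_const_bound[where B = "real n * (BK * BP)"]) auto
  have L_eq: "loglik K Psi X n h x0 \<theta> \<omega> = S \<omega> \<bullet> \<theta> - G \<theta>" for \<theta> \<omega>
    by (simp add: loglik_def S_def T_def G_def inner_sum_left)
  have L_deriv: "((\<lambda>\<theta>. s \<bullet> \<theta> - G \<theta>) has_derivative (\<lambda>v. (s - mean_map \<theta>) \<bullet> v)) (at \<theta>)" for s \<theta>
    unfolding G_def by (rule log_partition_derivative)
  have grad: "gradL \<omega> = S \<omega> - mean_map theta_s" for \<omega>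
    unfolding gradL_def L_eq by (rule grad_at_eqI) (rule L_deriv)
  have "S \<omega> - mean_map (theta_t \<omega>) = 0" if "\<omega> \<in> space M" for \<omega>
    by (rule derivative_zero_at_max[OF L_deriv]) (use theta_t_max[OF that] in \<open>simp add: L_def L_eq\<close>)
  then have grad_t: "gradL \<omega> = mean_map (theta_t \<omega>) - mean_map theta_s" if "\<omega> \<in> space M" for \<omega>
    using that by (simp add: grad)
  have EL: "expectation (L \<theta>) = expectation S \<bullet> \<theta> - G \<theta>" for \<theta>
    using S_int by (simp add: L_def L_eq[abs_def] prob_space)
  \<comment> \<open>The expected likelihood is critical at \<open>theta_s\<close>, so the score
    there is centred and the centring term in (ED0) vanishes.\<close>
  have "expectation S - mean_map theta_s = 0"
    by (rule derivative_zero_at_max[OF L_deriv]) (use theta_s_max in \<open>simp add: EL\<close>)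
  then have E_grad: "expectation gradL = 0"
    using S_int by (simp add: grad[abs_def] prob_space)
  have gradL_meas [measurable]: "gradL \<in> borel_measurable M"
    unfolding grad[abs_def] by measurable
  define BG where "BG = real n * (BK * BP) + norm (mean_map theta_s)"
  have gradL_bdd: "norm (gradL \<omega>) \<le> BG" for \<omega>
    using S_bdd[of \<omega>] norm_triangle_ineq4[of "S \<omega>" "mean_map theta_s"] by (simp add: grad BG_def)
  have gradL_int: "integrable M gradL"
    using gradL_bdd by (intro integrable_const_bound[where B = BG]) auto
  have E_grad_nth: "expectation (\<lambda>\<omega>. gradL \<omega> $ j) = 0" for j
    using integral_bounded_linear[OF bounded_linear_vec_nth gradL_int, of j] E_grad by simp

  have D_inv: "invertible D" and V_inv: "invertible V"
    using D_pd V_pd by (auto intro: pos_def_invertible)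
  define Y where "Y = (\<lambda>\<omega>. matrix_inv V *v gradL \<omega>)"
  have bl: "bounded_linear (\<lambda>x. matrix_inv V *v x)" by (rule matrix_vector_mul_bounded_linear)
  have Y_meas [measurable]: "Y \<in> borel_measurable M"
    unfolding Y_def
    by (rule measurable_compose[OF gradL_meas])
       (intro borel_measurable_continuous_onI linear_continuous_on bl)
  have Y_bdd: "norm (Y \<omega>) \<le> onorm (\<lambda>x. matrix_inv V *v x) * BG" for \<omega>
    unfolding Y_def using onorm[OF bl] onorm_pos_le[OF bl] gradL_bdd
    by (meson mult_left_mono order_trans)
  have EY: "expectation Y = 0"
    unfolding Y_def using integral_bounded_linear[OF bl gradL_int] E_grad by simp
  have mgf: "expectation (\<lambda>\<omega>. exp (v \<bullet> Y \<omega>)) \<le> exp (\<nu>0\<^sup>2 * (norm v)\<^sup>2 / 2)" if "norm v \<le> g" for v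
  proof (cases "v = 0")
    case True
    then show ?thesis by (simp add: prob_space)
  next
    case False
    have "ln (expectation (\<lambda>\<omega>. exp (v \<bullet> Y \<omega>))) \<le> \<nu>0\<^sup>2 * (norm v)\<^sup>2 / 2"
      using cond_ED0[OF False, of "norm v"] that False
      unfolding EY[unfolded Y_def] by (simp add: Y_def)
    \<comment> \<open>The logarithmic form of (ED0) can be exponentiated only at a positive
      argument; otherwise the bound is immediate from positivity of exp.\<close>
    then show ?thesis
      by (cases "expectation (\<lambda>\<omega>. exp (v \<bullet> Y \<omega>)) > 0")
         (metis exp_le_cancel_iff exp_ln, meson exp_ge_zero not_less order_trans)
  qed
  have "1 \<le> \<nu>0\<^sup>2"
  proof -
    define e :: "real^'p" where "e = axis i0 1"
    \<comment> \<open>With e a unit vector, e . Y equals x . gradL, whose second moment is the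
      squared norm of V x = e, that is 1.\<close>
    define x where "x = matrix_inv V *v e"
    have Vx: "V *v x = e" using V_inv by (simp add: x_def)
    have "expectation (\<lambda>\<omega>. (e \<bullet> Y \<omega>)\<^sup>2) \<le> \<nu>0\<^sup>2"
    proof (rule mgf_bound_ge_variance[OF _ _ _ g_pos])
      show "(\<lambda>\<omega>. e \<bullet> Y \<omega>) \<in> borel_measurable M" by simp
      show "\<bar>e \<bullet> Y \<omega>\<bar> \<le> onorm (\<lambda>x. matrix_inv V *v x) * BG" for \<omega>
        using Cauchy_Schwarz_ineq2[of e "Y \<omega>"] Y_bdd[of \<omega>] by (simp add: e_def)
      show "expectation (\<lambda>\<omega>. exp (s * (e \<bullet> Y \<omega>))) \<le> exp (\<nu>0\<^sup>2 * s\<^sup>2 / 2)" if "\<bar>s\<bar> \<le> g" for s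
        using mgf[of "s *\<^sub>R e"] that by (simp add: e_def)
    qed
    moreover have "expectation (\<lambda>\<omega>. (e \<bullet> Y \<omega>)\<^sup>2) = expectation (\<lambda>\<omega>. (x \<bullet> gradL \<omega>)\<^sup>2)"
      by (simp add: Y_def x_def sym_mat_inner_inv[OF V_sym V_inv])
    moreover have "\<dots> = x \<bullet> (covmat M gradL *v x)"
      by (rule covmat_quadratic[OF gradL_meas gradL_bdd E_grad_nth, symmetric])
    moreover have "\<dots> = (V *v x) \<bullet> (V *v x)"
      unfolding V_sq[symmetric] matrix_vector_mul_assoc[symmetric] by (rule sym_mat_inner[OF V_sym, symmetric])
    moreover have "\<dots> = 1" by (simp add: Vx e_def inner_axis)
    ultimately show ?thesis by simp
  qed
  then have nu1: "\<nu>0 \<ge> 1" using nu0_pos by (simp add: power2_le_imp_le[of 1 \<nu>0])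

  \<comment> \<open>Multiplied by \<open>a\<close> this radius is \<open>2 * zeta_pz\<close>, the
    quantity that (C) compares with \<open>r0 * (1 - \<delta>)\<close>.\<close>
  let ?t = "2 * \<nu>0 * (sqrt (real CARD('p)) + sqrt (2 * z))"
  define A where "A = {\<omega> \<in> space M. norm (Y \<omega>) < ?t}"
  have A_sets: "A \<in> sets M" unfolding A_def by measurable
  have "prob (space M - A) \<le> 2 * exp (- z)"
    using prob_norm_ge_of_mgf_bound[OF Y_meas Y_bdd mgf nu1 g_pos z_pos z_le]
    by (simp add: A_def set_diff_eq not_less conj_ac cong: conj_cong)
  \<comment> \<open>The deviation bound gives 1 - 2 exp(-z); subtracting the further nonnegative
    term only lowers the right side.\<close>
  then have "prob A \<ge> 1 - (2 * exp (- z) + 8.4 * exp (- g\<^sup>2 / 4))"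
    using prob_compl[OF A_sets] exp_ge_zero[of "- g\<^sup>2 / 4"] by linarith
  moreover have "norm (D *v (theta_t \<omega> - theta_s)) \<le> r0 \<and>
      norm (D *v (theta_t \<omega> - theta_s) - matrix_inv D *v gradL \<omega>) \<le> r0 * \<delta>" if "\<omega> \<in> A" for \<omega>
  proof -
    have \<omega>: "\<omega> \<in> space M" "norm (Y \<omega>) < ?t" using that by (auto simp: A_def)
    have "norm (matrix_inv D *v gradL \<omega>) \<le> a * norm (Y \<omega>)"
      unfolding Y_def
      by (rule norm_inv_le_of_loewner_le[OF D_sym D_inv V_sym V_inv a_pos]) (simp add: D_sq V_sq cond_I)
    also have "\<dots> < a * ?t" using \<omega> a_pos by simp
    also have "\<dots> = 2 * zeta_pz" by (simp add: zeta_pz_def)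
    also have "\<dots> \<le> r0 * (1 - \<delta>)" by (rule cond_C)
    finally have small: "norm (matrix_inv D *v (mean_map (theta_t \<omega>) - mean_map theta_s)) < r0 * (1 - \<delta>)"
      by (simp add: grad_t[OF \<omega>(1)])
    have "r0 > 0"
      using a_pos nu0_pos z_pos by (auto simp: r0_def intro!: mult_pos_pos add_nonneg_pos)
    from monotone_map_inversion_near_point[OF mean_map_line_derivative Dn2_psd D_sym D_inv cond_L0 this delta_nonneg small]
    show ?thesis by (simp add: grad_t[OF \<omega>(1)])
  qed
  ultimately show ?thesis using A_sets by blast
qed

end
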